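(* Let $A\in\mathbb{R}^{m\times n}$. Suppose $B\subseteq\{1,\dots,n\}$ is an ordered set of indices such that $A_B$ has affinely independent columns and the pseudoinverse $\tilde{A}_B^\dagger$ is known. Let $j\in\{1,\dots,n\}\setminus B$, let $B':=[B,\,j]$ be the ordered set obtained by appending $j$ to $B$, and suppose $z=Ax=A_Bx_B+A_jx_j$ for some $x\in\Delta_{n-1}$ with $x_i=0$ for all $i\notin B'$. Then in $O(m^2)$ operations (with an absolute implied constant) one can find $x^+\in\Delta_{n-1}$, an ordered set of indices $B^+\subseteq B'$, and the pseudoinverse $\tilde{A}_{B^+}^\dagger$, such that $z=Ax=A_{B^+}x^+_{B^+}$ and $A_{B^+}$ has affinely independent columns.
   Context: $\Delta_{n-1}:=\{x\in\mathbb{R}^n:\|x\|_1=1,\ x\ge 0\}$ is the standard simplex. For an ordered set of (distinct) indices $B=[B(1),\dots,B(k)]\subseteq\{1,\dots,n\}$, a matrix $A\in\mathbb{R}^{m\times n}$ and $x\in\mathbb{R}^n$: $A_i$ denotes the $i$-th column of $A$, $A_B=[A_{B(1)}\ \cdots\ A_{B(k)}]\in\mathbb{R}^{m\times k}$, and $x_B=(x_{B(1)},\dots,x_{B(k)})\in\mathbb{R}^k$. The inclusion $B^+\subseteq B'$ is an inclusion of the underlying sets (the order in $B^+$ may be chosen). $\tilde{A}\in\mathbb{R}^{(m+1)\times n}$ denotes the matrix obtained from $A$ by adding a row of ones on top, and $\tilde{A}_B$, $\tilde{A}_j$ denote the corresponding column submatrix and column of $\tilde A$; the columns of $A_B$ are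 affinely independent exactly when $\tilde{A}_B$ has full column rank. For a full column rank matrix $M$, $M^\dagger=(M^TM)^{-1}M^T$. "Operations" are arithmetic operations and comparisons on real numbers. Here $m\ge 1$. *)

theory Defs
  imports
    Complex_Main
    "Jordan_Normal_Form.Matrix"
    "Jordan_Normal_Form.Gauss_Jordan_Elimination"
begin

text \<open>Matrices and vectors are those of Jordan Normal Form, so rows, columns and index lists
  are 0-based: the index set {1,...,n} of the mathematics is {0..<n} here.\<close>

definition simplex :: "nat \<Rightarrow> real vec set" where
  "simplex n = {x \<in> carrier_vec n. (\<Sum>i<n. \<bar>x $ i\<bar>) = 1 \<and> (\<forall>i<n. 0 \<le> x $ i)}"

definition ordered_index_set :: "nat \<Rightarrow> nat list \<Rightarrow> bool" where
  "ordered_index_set n B \<longleftrightarrow> distinct B \<and> set B \<subseteq> {..<n}"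

definition sub_cols :: "real mat \<Rightarrow> nat list \<Rightarrow> real mat" where
  "sub_cols A B = mat_of_cols (dim_row A) (map (col A) B)"

definition sub_vec :: "real vec \<Rightarrow> nat list \<Rightarrow> real vec" where
  "sub_vec x B = vec_of_list (map (($) x) B)"

definition ones_on_top :: "real mat \<Rightarrow> real mat" where
  "ones_on_top A = mat (dim_row A + 1) (dim_col A)
     (\<lambda>(i, l). if i = 0 then 1 else A $$ (i - 1, l))"

text \<open>Affine independence of the columns as an indexed family, so a repeated column makes
  the family dependent.\<close>

definition affinely_independent_cols :: "real mat \<Rightarrow> bool" where
  "affinely_independent_cols M \<longleftrightarrow>
     (\<forall>c \<in> carrier_vec (dim_col M).
        M *\<^sub>v c = 0\<^sub>v (dim_row M) \<and> (\<Sum>i<dim_col M. c $ i) = 0 \<longrightarrow> c = 0\<^sub>v (dim_col M))"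

text \<open>Meaningful only if \<open>M\<close> has full column rank; otherwise the Gram matrix is
  singular and the value is unspecified.\<close>

definition pinv :: "real mat \<Rightarrow> real mat" where
  "pinv M = the (mat_inverse (transpose_mat M * M)) * transpose_mat M"


text \<open>Model of computation: uniform programs over a memory of named two-dimensional arrays,
  one family of arrays holding natural numbers (dimensions, indices) and one holding real numbers.
  Real numbers influence control flow and natural-number data only through comparisons of reals,
  and the only real constants are 0 and 1. The cost of a run is the number of arithmetic operations
  and comparisons on real numbers it performs; index computations and data movement are not
  counted. Loop bounds are evaluated once, on entry, so all programs terminate.

  Division follows the HOL convention \<open>x / 0 = 0\<close>. This gives no additional power
  up to a constant factor in the cost, as each division can be guarded by one comparison.\<close>

record state =
  nats :: "string \<Rightarrow> nat \<Rightarrow> nat \<Rightarrow> nat"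
  reals :: "string \<Rightarrow> nat \<Rightarrow> nat \<Rightarrow> real"

datatype nat_exp =
    NConst nat
  | NGet string nat_exp nat_exp
  | NAdd nat_exp nat_exp
  | NSub nat_exp nat_exp
  | NMul nat_exp nat_exp

datatype real_exp =
    RZero
  | ROne
  | RGet string nat_exp nat_exp
  | RAdd real_exp real_exp
  | RSub real_exp real_exp
  | RMul real_exp real_exp
  | RDiv real_exp real_exp

datatype bool_exp =
    NLess nat_exp nat_exp
  | NEq nat_exp nat_exp
  | RLess real_exp real_exp
  | REq real_exp real_exp
  | BNot bool_exp
  | BAnd bool_exp bool_exp

datatype prog =
    Skip
  | NSet string nat_exp nat_exp nat_exp
  | RSet string nat_exp nat_exp real_exp
  | Seq prog prog
  | IfThenElse bool_exp prog prog
  | For string nat_exp prog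

primrec neval :: "nat_exp \<Rightarrow> state \<Rightarrow> nat" where
  "neval (NConst c) s = c"
| "neval (NGet a e f) s = nats s a (neval e s) (neval f s)"
| "neval (NAdd e f) s = neval e s + neval f s"
| "neval (NSub e f) s = neval e s - neval f s"
| "neval (NMul e f) s = neval e s * neval f s"

primrec reval :: "real_exp \<Rightarrow> state \<Rightarrow> real" where
  "reval RZero s = 0"
| "reval ROne s = 1"
| "reval (RGet a e f) s = reals s a (neval e s) (neval f s)"
| "reval (RAdd e f) s = reval e s + reval f s"
| "reval (RSub e f) s = reval e s - reval f s"
| "reval (RMul e f) s = reval e s * reval f s"
| "reval (RDiv e f) s = reval e s / reval f s"

primrec rcost :: "real_exp \<Rightarrow> nat" where
  "rcost RZero = 0"
| "rcost ROne = 0"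
| "rcost (RGet a e f) = 0"
| "rcost (RAdd e f) = rcost e + rcost f + 1"
| "rcost (RSub e f) = rcost e + rcost f + 1"
| "rcost (RMul e f) = rcost e + rcost f + 1"
| "rcost (RDiv e f) = rcost e + rcost f + 1"

primrec beval :: "bool_exp \<Rightarrow> state \<Rightarrow> bool" where
  "beval (NLess e f) s \<longleftrightarrow> neval e s < neval f s"
| "beval (NEq e f) s \<longleftrightarrow> neval e s = neval f s"
| "beval (RLess e f) s \<longleftrightarrow> reval e s < reval f s"
| "beval (REq e f) s \<longleftrightarrow> reval e s = reval f s"
| "beval (BNot b) s \<longleftrightarrow> \<not> beval b s"
| "beval (BAnd b c) s \<longleftrightarrow> beval b s \<and> beval c s"

primrec bcost :: "bool_exp \<Rightarrow> nat" where
  "bcost (NLess e f) = 0"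
| "bcost (NEq e f) = 0"
| "bcost (RLess e f) = rcost e + rcost f + 1"
| "bcost (REq e f) = rcost e + rcost f + 1"
| "bcost (BNot b) = bcost b"
| "bcost (BAnd b c) = bcost b + bcost c"

definition set_nat :: "string \<Rightarrow> nat \<Rightarrow> nat \<Rightarrow> nat \<Rightarrow> state \<Rightarrow> state" where
  "set_nat a i l v s = s\<lparr>nats := (nats s)(a := (nats s a)(i := (nats s a i)(l := v)))\<rparr>"

definition set_real :: "string \<Rightarrow> nat \<Rightarrow> nat \<Rightarrow> real \<Rightarrow> state \<Rightarrow> state" where
  "set_real a i l v s = s\<lparr>reals := (reals s)(a := (reals s a)(i := (reals s a i)(l := v)))\<rparr>"

text \<open>\<open>exec p s\<close> is the final state together with the cost of the run. A scalar,
  such as a loop counter, is the entry (0,0) of its array.\<close>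

primrec exec :: "prog \<Rightarrow> state \<Rightarrow> state \<times> nat" where
  "exec Skip s = (s, 0)"
| "exec (NSet a e f g) s = (set_nat a (neval e s) (neval f s) (neval g s) s, 0)"
| "exec (RSet a e f g) s = (set_real a (neval e s) (neval f s) (reval g s) s, rcost g)"
| "exec (Seq p q) s =
     (let (s', t) = exec p s; (s'', t') = exec q s' in (s'', t + t'))"
| "exec (IfThenElse b p q) s =
     (let (s', t) = (if beval b s then exec p s else exec q s) in (s', bcost b + t))"
| "exec (For v e p) s =
     fold (\<lambda>i (s', t). let (s'', t') = exec p (set_nat v 0 0 i s') in (s'', t + t'))
       [0..<neval e s] (s, 0)"

definition holds_nat :: "state \<Rightarrow> string \<Rightarrow> nat \<Rightarrow> bool" where
  "holds_nat s a c \<longleftrightarrow> nats s a 0 0 = c"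

definition holds_list :: "state \<Rightarrow> string \<Rightarrow> nat list \<Rightarrow> bool" where
  "holds_list s a L \<longleftrightarrow> (\<forall>i < length L. nats s a i 0 = L ! i)"

definition holds_vec :: "state \<Rightarrow> string \<Rightarrow> real vec \<Rightarrow> bool" where
  "holds_vec s a v \<longleftrightarrow> (\<forall>i < dim_vec v. reals s a i 0 = v $ i)"

definition holds_mat :: "state \<Rightarrow> string \<Rightarrow> real mat \<Rightarrow> bool" where
  "holds_mat s a M \<longleftrightarrow> (\<forall>i < dim_row M. \<forall>l < dim_col M. reals s a i l = M $$ (i, l))"

text \<open>All memory not mentioned here is arbitrary. In particular a program is
  given the point \<open>z\<close>, but cannot rely on being given a representation
  \<open>z = A x\<close> of it.\<close>

definition input_state ::
    "state \<Rightarrow> real mat \<Rightarrow> nat list \<Rightarrow> nat \<Rightarrow> real vec \<Rightarrow> real mat \<Rightarrow> bool" where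
  "input_state s A B j z P \<longleftrightarrow>
     holds_nat s ''m'' (dim_row A) \<and> holds_nat s ''n'' (dim_col A) \<and> holds_mat s ''A'' A \<and>
     holds_nat s ''k'' (length B) \<and> holds_list s ''B'' B \<and> holds_nat s ''j'' j \<and>
     holds_vec s ''z'' z \<and> holds_mat s ''P'' P"

definition output_state :: "state \<Rightarrow> real vec \<Rightarrow> nat list \<Rightarrow> real mat \<Rightarrow> bool" where
  "output_state s x B P \<longleftrightarrow>
     holds_vec s ''x_out'' x \<and>
     holds_nat s ''k_out'' (length B) \<and> holds_list s ''B_out'' B \<and> holds_mat s ''P_out'' P"

end

theory Submission
  imports Defs "Jordan_Normal_Form.Determinant"
begin

text \<open>Let \<open>M\<close> consist of the columns of the lifted matrix indexed by \<open>B\<close>, let \<open>P\<close> be its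
  pseudoinverse, \<open>v\<close> the lifted column \<open>j\<close> and \<open>w = (1, z)\<close>. Put \<open>d = P v\<close>, \<open>y = P w\<close> and \<open>r = v - M d\<close>.

  If \<open>r \<noteq> 0\<close>, then \<open>j\<close> is appended to \<open>B\<close>, and the new row of the pseudoinverse is \<open>g = r / |r|^2\<close>
  (Greville's formula). If \<open>r = 0\<close>, then \<open>v = M d\<close> with \<open>\<Sum> d = 1\<close>, so some \<open>d a\<close> is positive; \<open>j\<close> replaces
  the index at the position \<open>l\<close> that minimises \<open>y a / d a\<close> over \<open>d a > 0\<close>, as in the simplex method. The
  new matrix is \<open>M E\<close> with \<open>E\<close> invertible, so its pseudoinverse is the inverse of \<open>E\<close> times \<open>P\<close>, with row \<open>g = P l / d l\<close>
  at position \<open>l\<close>.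

  In both cases the remaining rows are \<open>P a - d a g\<close>, and the new point has coordinates \<open>\<tau> = g w\<close>
  at \<open>j\<close> and \<open>y a - d a \<tau>\<close> at \<open>B ! a\<close>. This takes \<open>O(k m)\<close> operations for \<open>k = length B\<close>,
  and \<open>k \<le> m + 1\<close>.\<close>

section \<open>Pseudoinverses and pivoting\<close>

text \<open>\<open>X\<close> is a left inverse of \<open>M\<close> and \<open>M X\<close> is
  symmetric; the remaining Penrose equations follow from \<open>X M = I\<close>. Matrices are plain
  functions of row and column here, so that replacing or adding a column is a mere
  \<open>if\<close>.\<close>

definition mp_inverse_on :: "nat \<Rightarrow> nat \<Rightarrow> (nat \<Rightarrow> nat \<Rightarrow> real) \<Rightarrow> (nat \<Rightarrow> nat \<Rightarrow> real) \<Rightarrow> bool" where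
  "mp_inverse_on p k M X \<longleftrightarrow>
     (\<forall>a<k. \<forall>b<k. (\<Sum>i<p. X a i * M i b) = of_bool (a = b)) \<and>
     (\<forall>i<p. \<forall>i'<p. (\<Sum>a<k. M i a * X a i') = (\<Sum>a<k. M i' a * X a i))"

lemma mp_inverse_on_left:
  assumes "mp_inverse_on p k M X" "a < k" "b < k"
  shows "(\<Sum>i<p. X a i * M i b) = of_bool (a = b)"
  using assms by (auto simp: mp_inverse_on_def)

lemma mp_inverse_on_sym:
  assumes "mp_inverse_on p k M X" "i < p" "i' < p"
  shows "(\<Sum>a<k. M i a * X a i') = (\<Sum>a<k. M i' a * X a i)"
  using assms by (auto simp: mp_inverse_on_def)

lemma sum_of_bool_left: "finite A \<Longrightarrow> (\<Sum>a\<in>A. of_bool (a = b) * f a) = (if b \<in> A then f b else (0::real))"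
  by (simp add: of_bool_def if_distrib[of "\<lambda>u. u * _"] cong: if_cong)

lemma mp_inverse_on_left_combination:
  assumes "mp_inverse_on p k M X" "a < k"
  shows "(\<Sum>i<p. X a i * (\<Sum>b<k. M i b * f b)) = f a"
proof -
  have "(\<Sum>i<p. X a i * (\<Sum>b<k. M i b * f b)) = (\<Sum>b<k. (\<Sum>i<p. X a i * M i b) * f b)"
    by (simp add: sum_distrib_left sum_distrib_right mult.assoc) (rule sum.swap)
  also have "\<dots> = (\<Sum>b<k. of_bool (b = a) * f b)"
    using assms by (intro sum.cong) (auto simp: mp_inverse_on_left)
  also have "\<dots> = f a" using assms(2) by (simp add: sum_of_bool_left)
  finally show ?thesis .
qed

text \<open>\<open>M X\<close> is an orthogonal projection, so its diagonal entries are at most 1, while its trace is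
  that of \<open>X M = I\<close>.\<close>

lemma mp_inverse_on_le:
  assumes "mp_inverse_on p k M X"
  shows "k \<le> p"
proof -
  define H where "H i i' = (\<Sum>a<k. M i a * X a i')" for i i'
  have idem: "H i i = (\<Sum>l<p. H i l * H l i)" if "i < p" for i
  proof -
    have "(\<Sum>l<p. H i l * H l i) = (\<Sum>l<p. \<Sum>a<k. M i a * (X a l * H l i))"
      by (simp add: H_def[of i] sum_distrib_right mult.assoc)
    also have "\<dots> = (\<Sum>a<k. M i a * (\<Sum>l<p. X a l * (\<Sum>b<k. M l b * X b i)))"
      by (subst sum.swap) (simp add: sum_distrib_left H_def)
    also have "\<dots> = H i i"
      by (simp add: mp_inverse_on_left_combination[OF assms] H_def)
    finally show ?thesis ..
  qed
  \<comment> \<open>By symmetry the diagonal entry of \<open>H H = H\<close> is the sum of the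
    squares in row \<open>i\<close>, which is at least the square of \<open>H i i\<close>; and
    \<open>h * h \<le> h\<close> forces \<open>h \<le> 1\<close>.\<close>
  have diag: "H i i \<le> 1" if "i < p" for i
  proof -
    have "(H i i)\<^sup>2 \<le> (\<Sum>l<p. (H i l)\<^sup>2)"
      using that by (intro member_le_sum[of i _ "\<lambda>l. (H i l)\<^sup>2"]) auto
    also have "\<dots> = (\<Sum>l<p. H i l * H l i)"
      using that mp_inverse_on_sym[OF assms]
      by (intro sum.cong) (auto simp: H_def power2_eq_square)
    finally have "(H i i)\<^sup>2 \<le> H i i" using idem[OF that] by simp
    then have "H i i * H i i \<le> H i i" by (simp add: power2_eq_square)
    then show ?thesis
      by (smt (verit) mult_le_cancel_left2)
  qed
  have "real k = (\<Sum>a<k. \<Sum>i<p. X a i * M i a)"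
    using assms by (simp add: mp_inverse_on_left)
  also have "\<dots> = (\<Sum>i<p. H i i)"
    unfolding H_def by (subst sum.swap) (simp add: mult.commute)
  also have "\<dots> \<le> (\<Sum>i<p. 1)" using diag by (intro sum_mono) auto
  finally show ?thesis by simp
qed

text \<open>Common form of both updates: \<open>l = k\<close> appends \<open>v\<close>, while
  \<open>l < k\<close> puts \<open>v\<close> in place of column \<open>l\<close>. A row
  \<open>X a - d a * g\<close> annihilates \<open>v\<close> because \<open>X v = d\<close> and
  \<open>g v = 1\<close>, and it acts on the old columns other than \<open>l\<close> as
  \<open>X a\<close> does, because \<open>g\<close> annihilates them. The hypothesis
  \<open>sym\<close> is the symmetry of the difference between the new and the old product
  \<open>M X\<close>.\<close>

lemma mp_inverse_on_pivot:
  assumes X: "mp_inverse_on p k M X"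
    and k': "l < k \<and> k' = k \<or> l = k \<and> k' = Suc k"
    and d: "\<And>a. a < k \<Longrightarrow> d a = (\<Sum>i<p. X a i * v i)"
    and gM: "\<And>b. b < k \<Longrightarrow> b \<noteq> l \<Longrightarrow> (\<Sum>i<p. g i * M i b) = 0"
    and gv: "(\<Sum>i<p. g i * v i) = 1"
    and sym: "\<And>i i'. i < p \<Longrightarrow> i' < p \<Longrightarrow>
       (v i - (\<Sum>a\<in>{..<k} - {l}. M i a * d a)) * g i' - (if l < k then M i l * X l i' else 0)
     = (v i' - (\<Sum>a\<in>{..<k} - {l}. M i' a * d a)) * g i - (if l < k then M i' l * X l i else 0)"
  shows "mp_inverse_on p k' (\<lambda>i a. if a = l then v i else M i a)
           (\<lambda>a i. if a = l then g i else X a i - d a * g i)"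
  unfolding mp_inverse_on_def
proof (intro conjI allI impI)
  fix a b assume ab: "a < k'" "b < k'"
  let ?S = "\<Sum>i<p. (if a = l then g i else X a i - d a * g i) * (if b = l then v i else M i b)"
  have lt: "c < k" if "c < k'" "c \<noteq> l" for c using that k' by auto
  have split: "(\<Sum>i<p. (X a i - c * g i) * f i) = (\<Sum>i<p. X a i * f i) - c * (\<Sum>i<p. g i * f i)" for c f
    by (simp add: left_diff_distrib sum_subtractf sum_distrib_left mult.assoc)
  show "?S = of_bool (a = b)"
    using ab lt[of a] lt[of b] gM[of b] gv d[of a] mp_inverse_on_left[OF X, of a b]
    by (cases "a = l"; cases "b = l") (auto simp: split)
next
  fix i i' assume ii: "i < p" "i' < p"
  \<comment> \<open>The new product is the old one plus a correction. The subtracted term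
    \<open>M i l * X l i'\<close> is the contribution of the column that leaves; for
    \<open>l = k\<close> there is none, and \<open>{..<k} - {l}\<close> is the full range.\<close>
  have *: "(\<Sum>a<k'. (if a = l then v i else M i a) * (if a = l then g i' else X a i' - d a * g i'))
     = (\<Sum>a<k. M i a * X a i') + ((v i - (\<Sum>a\<in>{..<k} - {l}. M i a * d a)) * g i' - (if l < k then M i l * X l i' else 0))"
    for i i'
  proof -
    have "{..<k'} = insert l ({..<k} - {l})" using k' by auto
    then have "(\<Sum>a<k'. (if a = l then v i else M i a) * (if a = l then g i' else X a i' - d a * g i'))
      = v i * g i' + (\<Sum>a\<in>{..<k} - {l}. M i a * (X a i' - d a * g i'))"
      by (simp del: insert_Diff_single)
    also have "(\<Sum>a\<in>{..<k} - {l}. M i a * (X a i' - d a * g i'))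
      = (\<Sum>a\<in>{..<k} - {l}. M i a * X a i') - (\<Sum>a\<in>{..<k} - {l}. M i a * d a) * g i'"
      by (simp add: right_diff_distrib sum_subtractf sum_distrib_right mult.assoc)
    also have "(\<Sum>a\<in>{..<k} - {l}. M i a * X a i') = (\<Sum>a<k. M i a * X a i') - (if l < k then M i l * X l i' else 0)"
      by (simp add: sum_diff1)
    finally show ?thesis by (simp add: left_diff_distrib)
  qed
  show "(\<Sum>a<k'. (if a = l then v i else M i a) * (if a = l then g i' else X a i' - d a * g i'))
      = (\<Sum>a<k'. (if a = l then v i' else M i' a) * (if a = l then g i else X a i - d a * g i))"
    unfolding * using sym[OF ii] mp_inverse_on_sym[OF X ii] by simp
qed

section \<open>The entering column: projection, residual and the two pivots\<close>

text \<open>The entering column \<open>v\<close> is split into its orthogonal projection onto the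
  column space of \<open>M\<close>, with coefficients \<open>d\<close>, and the residual
  \<open>r\<close>. The squared norm \<open>rho\<close> of \<open>r\<close> lets a single comparison
  decide whether \<open>v\<close> lies in that space.\<close>

locale column_append =
  fixes p k :: nat and M X :: "nat \<Rightarrow> nat \<Rightarrow> real" and v :: "nat \<Rightarrow> real"
  assumes X: "mp_inverse_on p k M X"
begin

definition d where "d a = (\<Sum>i<p. X a i * v i)"
definition r where "r i = v i - (\<Sum>a<k. M i a * d a)"
definition rho where "rho = (\<Sum>i<p. r i * r i)"

lemma rho_zero_iff: "rho = 0 \<longleftrightarrow> (\<forall>i<p. r i = 0)"
  unfolding rho_def by (subst sum_nonneg_eq_0_iff) auto

text \<open>The residual is orthogonal to the columns of \<open>M\<close> because \<open>M X\<close> is symmetric.\<close>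

lemma r_orthogonal:
  assumes "b < k"
  shows "(\<Sum>i<p. r i * M i b) = 0"
proof -
  have *: "(\<Sum>a<k. M i a * d a) = (\<Sum>i'<p. (\<Sum>a<k. M i a * X a i') * v i')" for i
    unfolding d_def sum_distrib_left sum_distrib_right by (subst sum.swap) (simp add: mult.assoc)
  have "(\<Sum>i<p. (\<Sum>a<k. M i a * d a) * M i b) = (\<Sum>i<p. \<Sum>i'<p. (\<Sum>a<k. M i a * X a i') * v i' * M i b)"
    unfolding * by (simp add: sum_distrib_right)
  also have "\<dots> = (\<Sum>i<p. \<Sum>i'<p. (\<Sum>a<k. M i' a * X a i) * v i' * M i b)"
    using mp_inverse_on_sym[OF X] by (intro sum.cong) auto
  also have "\<dots> = (\<Sum>i'<p. \<Sum>i<p. \<Sum>a<k. v i' * (M i' a * (X a i * M i b)))"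
    by (subst sum.swap) (simp add: sum_distrib_left sum_distrib_right mult_ac)
  also have "\<dots> = (\<Sum>i'<p. v i' * (\<Sum>a<k. M i' a * (\<Sum>i<p. X a i * M i b)))"
    by (intro sum.cong refl) (subst sum.swap, simp add: sum_distrib_left)
  also have "\<dots> = (\<Sum>i'<p. v i' * (\<Sum>a<k. of_bool (a = b) * M i' a))"
    using assms by (simp add: mp_inverse_on_left[OF X] mult.commute[of _ "of_bool _"])
  also have "\<dots> = (\<Sum>i'<p. v i' * M i' b)" using assms by (simp add: sum_of_bool_left)
  finally show ?thesis by (simp add: r_def left_diff_distrib sum_subtractf)
qed

text \<open>\<open>v\<close> is \<open>r\<close> plus a combination of columns of \<open>M\<close>,
  and these are orthogonal to \<open>r\<close>.\<close>

lemma r_v: "(\<Sum>i<p. r i * v i) = rho"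
proof -
  have "(\<Sum>i<p. r i * (\<Sum>a<k. M i a * d a)) = (\<Sum>a<k. (\<Sum>i<p. r i * M i a) * d a)"
    by (simp add: sum_distrib_left sum_distrib_right mult.assoc) (rule sum.swap)
  also have "\<dots> = 0" by (simp add: r_orthogonal)
  finally have "(\<Sum>i<p. r i * (\<Sum>a<k. M i a * d a)) = 0" .
  moreover have "rho = (\<Sum>i<p. r i * v i) - (\<Sum>i<p. r i * (\<Sum>a<k. M i a * d a))"
    unfolding rho_def sum_subtractf[symmetric] right_diff_distrib[symmetric] by (simp add: r_def)
  ultimately show ?thesis by simp
qed

text \<open>Orthogonality of \<open>r\<close> to the columns of \<open>M\<close> and
  \<open>r v = rho\<close> give the two conditions on the new row. The correction of the projection
  is \<open>r i * r i' / rho\<close>, which is symmetric in \<open>i\<close> and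
  \<open>i'\<close>.\<close>

lemma append_case:
  assumes "rho \<noteq> 0" and g: "\<And>i. i < p \<Longrightarrow> g i = r i / rho"
  shows "mp_inverse_on p (Suc k) (\<lambda>i a. if a = k then v i else M i a)
           (\<lambda>a i. if a = k then g i else X a i - d a * g i)"
proof (rule mp_inverse_on_pivot[OF X])
  show "(\<Sum>i<p. g i * M i b) = 0" if "b < k" for b
    using r_orthogonal[OF that] by (simp add: g flip: sum_divide_distrib)
  show "(\<Sum>i<p. g i * v i) = 1" using r_v assms(1) by (simp add: g flip: sum_divide_distrib)
  show "(v i - (\<Sum>a\<in>{..<k} - {k}. M i a * d a)) * g i' - (if k < k then M i k * X k i' else 0)
     = (v i' - (\<Sum>a\<in>{..<k} - {k}. M i' a * d a)) * g i - (if k < k then M i' k * X k i else 0)"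
    if "i < p" "i' < p" for i i' using that by (simp add: g flip: r_def)
qed (auto simp: d_def)

text \<open>As \<open>v = M d\<close>, removing the terms other than \<open>l\<close> leaves
  \<open>M i l * d l\<close>. Multiplied by \<open>X l i' / d l\<close> this cancels the
  contribution of the leaving column, so the projection \<open>M X\<close> does not change: the
  column space stays the same.\<close>

lemma exchange_case:
  assumes "rho = 0" "l < k" "d l \<noteq> 0" and g: "\<And>i. i < p \<Longrightarrow> g i = X l i / d l"
  shows "mp_inverse_on p k (\<lambda>i a. if a = l then v i else M i a)
           (\<lambda>a i. if a = l then g i else X a i - d a * g i)"
proof (rule mp_inverse_on_pivot[OF X])
  show "(\<Sum>i<p. g i * M i b) = 0" if "b < k" "b \<noteq> l" for b
    using that assms mp_inverse_on_left[OF X \<open>l < k\<close> \<open>b < k\<close>]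
    by (simp add: g flip: sum_divide_distrib)
  show "(\<Sum>i<p. g i * v i) = 1" using assms(3) by (simp add: g d_def flip: sum_divide_distrib)
  have "v i - (\<Sum>a\<in>{..<k} - {l}. M i a * d a) = M i l * d l" if "i < p" for i
    using that assms(1,2) unfolding rho_zero_iff by (simp add: r_def sum_diff1)
  then show "(v i - (\<Sum>a\<in>{..<k} - {l}. M i a * d a)) * g i' - (if l < k then M i l * X l i' else 0)
     = (v i' - (\<Sum>a\<in>{..<k} - {l}. M i' a * d a)) * g i - (if l < k then M i' l * X l i else 0)"
    if "i < p" "i' < p" for i i' using that assms by (simp add: g)
qed (use assms in \<open>auto simp: d_def\<close>)

text \<open>For \<open>rho = 0\<close> every \<open>(y - t d, t)\<close> solves the system extended by the column \<open>v\<close>. The ratio test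
  picks the largest \<open>t\<close> for which all coordinates with \<open>d a > 0\<close> are nonnegative, and the given
  solution shows that the others remain so. For \<open>rho \<noteq> 0\<close> the solution is unique.\<close>

lemma pivot_point:
  assumes w_eq: "\<forall>i<p. w i = (\<Sum>a<k. M i a * c a) + t * v i"
    and c_nonneg: "\<forall>a<k. 0 \<le> c a" and t: "0 \<le> t"
    and y: "\<And>a. y a = (\<Sum>i<p. X a i * w i)"
    and tau: "tau = (\<Sum>i<p. g i * w i)"
    and cases: "rho \<noteq> 0 \<and> l = k \<and> k' = Suc k \<and> (\<forall>i<p. g i = r i / rho) \<or>
       rho = 0 \<and> l < k \<and> k' = k \<and> 0 < d l \<and> (\<forall>b<k. 0 < d b \<longrightarrow> y l / d l \<le> y b / d b) \<and>
         (\<forall>i<p. g i = X l i / d l)"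
  shows "mp_inverse_on p k' (\<lambda>i a. if a = l then v i else M i a)
           (\<lambda>a i. if a = l then g i else X a i - d a * g i)"
    and "0 \<le> tau"
    and "\<And>a. a < k \<Longrightarrow> 0 \<le> y a - d a * tau"
    and "l < k \<Longrightarrow> y l - d l * tau = 0"
    and "\<And>i. i < p \<Longrightarrow> (\<Sum>a<k. M i a * (y a - d a * tau)) + tau * v i = w i"
proof -
  have w: "w i = (\<Sum>a<k. M i a * c a) + t * v i" if "i < p" for i using w_eq that by blast
  have c: "0 \<le> c a" if "a < k" for a using c_nonneg that by blast
  show "mp_inverse_on p k' (\<lambda>i a. if a = l then v i else M i a)
           (\<lambda>a i. if a = l then g i else X a i - d a * g i)"
    using cases append_case exchange_case by auto
  \<comment> \<open>Apply the left inverse \<open>X\<close> to \<open>w = M c + t v\<close>.\<close>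
  have y': "y a = c a + t * d a" if "a < k" for a
  proof -
    have "y a = (\<Sum>i<p. X a i * (\<Sum>b<k. M i b * c b)) + t * d a"
      using that by (simp add: y w d_def distrib_left sum.distrib sum_distrib_left mult_ac)
    then show ?thesis using mp_inverse_on_left_combination[OF X that] by simp
  qed
  have gw: "tau = (\<Sum>i<p. g i * (\<Sum>b<k. M i b * c b)) + t * (\<Sum>i<p. g i * v i)"
    by (simp add: tau w distrib_left sum.distrib sum_distrib_left mult_ac)
  \<comment> \<open>The row \<open>g\<close> annihilates the columns of \<open>M\<close> and
    satisfies \<open>g v = 1\<close>, so only \<open>t\<close> survives in
    \<open>gw\<close>.\<close>
  have tau': "tau = t \<and> l \<ge> k" if "rho \<noteq> 0"
  proof -
    have g: "g i = r i / rho" if "i < p" for i using cases that \<open>rho \<noteq> 0\<close> by auto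
    have "(\<Sum>i<p. g i * (\<Sum>b<k. M i b * c b)) = (\<Sum>b<k. (\<Sum>i<p. r i * M i b) * c b / rho)"
      by (simp add: sum_distrib_left sum_distrib_right sum_divide_distrib mult.assoc g) (rule sum.swap)
    also have "\<dots> = 0" by (simp add: r_orthogonal)
    finally show ?thesis
      using gw r_v cases that by (auto simp: g simp flip: sum_divide_distrib)
  qed
  \<comment> \<open>Here \<open>tau\<close> is the minimal ratio. It is at least \<open>t\<close>
    because \<open>y l = c l + t * d l\<close> with \<open>c l\<close> nonnegative and
    \<open>d l\<close> positive.\<close>
  have tau'': "tau = y l / d l" "t \<le> tau" "0 < d l" "\<And>b. b < k \<Longrightarrow> 0 < d b \<Longrightarrow> tau \<le> y b / d b" if "rho = 0"
  proof -
    have g: "g i = X l i / d l" if "i < p" for i using cases that \<open>rho = 0\<close> by auto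
    have l: "l < k" and dl: "0 < d l" using cases that by auto
    show tl: "tau = y l / d l" using l by (simp add: tau y g sum_divide_distrib)
    show "t \<le> tau" using l dl c[OF l] by (simp add: tl y' field_simps)
    show "0 < d l" by fact
    show "tau \<le> y b / d b" if "b < k" "0 < d b" for b using that cases \<open>rho = 0\<close> tl by auto
  qed
  show "0 \<le> tau" using tau' tau''(2) t by fastforce
  show "0 \<le> y a - d a * tau" if a: "a < k" for a
  proof (cases "rho = 0")
    case True
    show ?thesis
    proof (cases "0 < d a")
      case True
      then show ?thesis using tau''(4)[OF \<open>rho = 0\<close> a] by (simp add: field_simps)
    next
      case False
      \<comment> \<open>For \<open>d a \<le> 0\<close> moving from \<open>t\<close> to the larger
        \<open>tau\<close> can only increase the coordinate, which at \<open>t\<close> equals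
        \<open>c a\<close>.\<close>
      then have "d a * tau \<le> d a * t" using tau''(2)[OF \<open>rho = 0\<close>] by (intro mult_left_mono_neg) auto
      then show ?thesis using y'[OF a] c[OF a] by (simp add: mult.commute)
    qed
  qed (use tau' y'[OF a] c[OF a] in auto)
  show "y l - d l * tau = 0" if "l < k" using that tau' tau'' by (cases "rho = 0") auto
  show "(\<Sum>a<k. M i a * (y a - d a * tau)) + tau * v i = w i" if "i < p" for i
  proof -
    \<comment> \<open>Substitute \<open>y = c + t d\<close> and \<open>M d = v - r\<close>. The
      error \<open>(t - tau) * r i\<close> vanishes in both cases: either \<open>tau = t\<close> or
      the residual is zero.\<close>
    have "(\<Sum>a<k. M i a * (y a - d a * tau)) = (\<Sum>a<k. M i a * c a) + (t - tau) * (\<Sum>a<k. M i a * d a)"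
      unfolding sum_distrib_left sum.distrib[symmetric]
      by (intro sum.cong) (auto simp: y' algebra_simps)
    also have "(\<Sum>a<k. M i a * d a) = v i - r i" by (simp add: r_def)
    finally have "(\<Sum>a<k. M i a * (y a - d a * tau)) = (\<Sum>a<k. M i a * c a) + (t - tau) * v i - (t - tau) * r i"
      by (simp add: right_diff_distrib)
    moreover have "(t - tau) * r i = 0" using that tau' rho_zero_iff by auto
    ultimately show ?thesis unfolding w[OF that] left_diff_distrib by linarith
  qed
qed

end

section \<open>Identification with the matrix \<open>pinv\<close>\<close>

lemma mp_inverse_on_iff:
  assumes M: "M \<in> carrier_mat p k" and X: "X \<in> carrier_mat k p"
  shows "mp_inverse_on p k (\<lambda>i a. M $$ (i, a)) (\<lambda>a i. X $$ (a, i)) \<longleftrightarrow>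
    X * M = 1\<^sub>m k \<and> transpose_mat (M * X) = M * X"
proof -
  have XM: "(X * M) $$ (a, b) = (\<Sum>i<p. X $$ (a, i) * M $$ (i, b))" if "a < k" "b < k" for a b
    using that M X by (simp add: scalar_prod_def atLeast0LessThan)
  have MX: "(M * X) $$ (i, i') = (\<Sum>a<k. M $$ (i, a) * X $$ (a, i'))" if "i < p" "i' < p" for i i'
    using that M X by (simp add: scalar_prod_def atLeast0LessThan)
  have 1: "X * M = 1\<^sub>m k \<longleftrightarrow> (\<forall>a<k. \<forall>b<k. (X * M) $$ (a, b) = of_bool (a = b))"
    using M X by (auto simp: mat_eq_iff simp del: index_mult_mat(1))
  have 2: "transpose_mat (M * X) = M * X \<longleftrightarrow> (\<forall>i<p. \<forall>i'<p. (M * X) $$ (i, i') = (M * X) $$ (i', i))"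
    using M X by (auto simp: mat_eq_iff simp del: index_mult_mat(1))
  show ?thesis unfolding 1 2 mp_inverse_on_def using XM MX by simp
qed

text \<open>Write \<open>G\<close> for the Gram matrix. Symmetry of \<open>M X\<close> and
  \<open>X M = I\<close> give \<open>G X = transpose M\<close>, hence
  \<open>G (X (transpose X)) = transpose (X M) = I\<close>. So \<open>G\<close> is invertible, and
  cancelling it in \<open>G X = transpose M\<close> yields the defining formula of
  \<open>pinv\<close>.\<close>

lemma pinv_unique:
  assumes M: "M \<in> carrier_mat p k" and X: "X \<in> carrier_mat k p"
    and mp: "mp_inverse_on p k (\<lambda>i a. M $$ (i, a)) (\<lambda>a i. X $$ (a, i))"
  shows "pinv M = X"
proof -
  let ?t = transpose_mat
  define G where "G = ?t M * M"
  have G: "G \<in> carrier_mat k k" using M by (simp add: G_def)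
  have XM: "X * M = 1\<^sub>m k" and MX: "?t (M * X) = M * X"
    using mp mp_inverse_on_iff[OF M X] by auto
  have GX: "G * X = ?t M"
  proof -
    have "G * X = ?t M * (M * X)"
      unfolding G_def by (rule assoc_mult_mat[of _ k p _ k _ p]) (use M X in auto)
    also have "\<dots> = ?t M * ?t (M * X)" by (simp add: MX)
    also have "\<dots> = ?t (M * X * M)" by (rule transpose_mult[symmetric]) (use M X in auto)
    also have "M * X * M = M * (X * M)" by (rule assoc_mult_mat) (use M X in auto)
    finally show ?thesis using M by (simp add: XM)
  qed
  have GXX: "G * (X * ?t X) = 1\<^sub>m k"
  proof -
    have "G * (X * ?t X) = G * X * ?t X" by (rule assoc_mult_mat[symmetric]) (use G X in auto)
    also have "\<dots> = ?t (X * M)" unfolding GX by (rule transpose_mult[symmetric]) (use M X in auto)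
    finally show ?thesis by (simp add: XM)
  qed
  have XX: "X * ?t X \<in> carrier_mat k k" using X by simp
  have "G \<in> Units (ring_mat TYPE(real) k ())"
    using G XX GXX mat_mult_left_right_inverse[OF G XX GXX]
    by (auto simp: Units_def ring_mat_simps)
  then obtain Y where Y: "mat_inverse G = Some Y" using mat_inverse(1)[OF G, of "()"] by (cases "mat_inverse G") auto
  then have YG: "Y * G = 1\<^sub>m k" and Yc: "Y \<in> carrier_mat k k" using mat_inverse(2)[OF G] by auto
  have "pinv M = Y * ?t M" using Y by (simp add: pinv_def G_def)
  also have "\<dots> = Y * G * X" unfolding GX[symmetric] by (rule assoc_mult_mat[symmetric]) (use G X Yc in auto)
  finally show ?thesis using X by (simp add: YG)
qed

text \<open>If \<open>G c = 0\<close> for the Gram matrix \<open>G\<close>, then the squared norm of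
  \<open>M c\<close> is \<open>c (G c) = 0\<close>, so injectivity of \<open>M\<close> makes
  \<open>G\<close> invertible. Its inverse \<open>Y\<close> gives the left inverse property
  directly, and \<open>M Y (transpose M)\<close> is symmetric because \<open>Y\<close> is.\<close>

lemma pinv_mp_inverse:
  assumes M: "M \<in> carrier_mat p k"
    and inj: "\<And>c. c \<in> carrier_vec k \<Longrightarrow> M *\<^sub>v c = 0\<^sub>v p \<Longrightarrow> c = 0\<^sub>v k"
  shows "pinv M \<in> carrier_mat k p"
    and "mp_inverse_on p k (\<lambda>i a. M $$ (i, a)) (\<lambda>a i. pinv M $$ (a, i))"
proof -
  let ?t = transpose_mat
  define G where "G = ?t M * M"
  have G: "G \<in> carrier_mat k k" using M by (simp add: G_def)
  have "det G \<noteq> 0"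
  proof
    assume "det G = 0"
    then obtain c where c: "c \<in> carrier_vec k" "c \<noteq> 0\<^sub>v k" "G *\<^sub>v c = 0\<^sub>v k"
      using det_0_iff_vec_prod_zero_field[OF G] by auto
    have Mc: "M *\<^sub>v c \<in> carrier_vec p" using M c by simp
    have "?t M *\<^sub>v (M *\<^sub>v c) = 0\<^sub>v k"
      using assoc_mult_mat_vec[of "?t M" k p M k c] c M by (simp add: G_def)
    then have "c \<bullet> (?t M *\<^sub>v (M *\<^sub>v c)) = 0" using c by simp
    then have "(M *\<^sub>v c) \<bullet> (M *\<^sub>v c) = 0"
      using transpose_vec_mult_scalar[OF M c(1) Mc] comm_scalar_prod[OF c(1), of "?t M *\<^sub>v (M *\<^sub>v c)"] M Mc
      by simp
    then have "(\<Sum>i<p. (M *\<^sub>v c) $ i * (M *\<^sub>v c) $ i) = 0"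
      using Mc unfolding scalar_prod_def atLeast0LessThan carrier_vecD[OF Mc] by blast
    then have "M *\<^sub>v c = 0\<^sub>v p"
      using Mc by (intro eq_vecI) (use M in \<open>auto simp: sum_nonneg_eq_0_iff simp del: index_mult_mat_vec\<close>)
    then show False using inj c by auto
  qed
  then have "G \<in> Units (ring_mat TYPE(real) k ())" using G by (rule det_non_zero_imp_unit[rotated])
  then obtain Y where Y: "mat_inverse G = Some Y" using mat_inverse(1)[OF G, of "()"] by (cases "mat_inverse G") auto
  then have YG: "Y * G = 1\<^sub>m k" and GY: "G * Y = 1\<^sub>m k" and Yc: "Y \<in> carrier_mat k k"
    using mat_inverse(2)[OF G] by auto
  have pinv: "pinv M = Y * ?t M" using Y by (simp add: pinv_def G_def)
  then show P: "pinv M \<in> carrier_mat k p" using Yc M by simp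
  \<comment> \<open>Transposing \<open>G Y = I\<close> shows that the transpose of \<open>Y\<close>
    also inverts the symmetric \<open>G\<close>, so it equals \<open>Y\<close>.\<close>
  have "?t Y * G = 1\<^sub>m k"
  proof -
    have Gt: "?t G = G" unfolding G_def using M by (subst transpose_mult[of _ k p _ k]) auto
    have "?t (G * Y) = ?t Y * ?t G" using G Yc by (rule transpose_mult)
    then show ?thesis by (simp add: GY Gt)
  qed
  then have Yt: "?t Y = Y"
    using assoc_mult_mat[of "?t Y" k k G k Y k] Yc G by (simp add: GY)
  have "pinv M * M = 1\<^sub>m k"
    unfolding pinv using assoc_mult_mat[of Y k k "?t M" p M k] Yc M YG by (simp add: G_def)
  moreover have "?t (M * pinv M) = M * pinv M"
  proof -
    have "?t (M * (Y * ?t M)) = ?t (Y * ?t M) * ?t M"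
      by (rule transpose_mult) (use M Yc in auto)
    also have "?t (Y * ?t M) = M * Y"
      using transpose_mult[of Y k k "?t M" p] M Yc by (simp add: Yt)
    also have "M * Y * ?t M = M * (Y * ?t M)" by (rule assoc_mult_mat) (use M Yc in auto)
    finally show ?thesis by (simp add: pinv)
  qed
  ultimately show "mp_inverse_on p k (\<lambda>i a. M $$ (i, a)) (\<lambda>a i. pinv M $$ (a, i))"
    using mp_inverse_on_iff[OF M P] by simp
qed

lemma mp_inverse_on_cong:
  assumes "mp_inverse_on p k M X"
    and "\<And>i a. i < p \<Longrightarrow> a < k \<Longrightarrow> M i a = M' i a" "\<And>i a. i < p \<Longrightarrow> a < k \<Longrightarrow> X a i = X' a i"
  shows "mp_inverse_on p k M' X'"
  using assms by (simp add: mp_inverse_on_def)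

section \<open>Lifted column submatrices and affine independence\<close>

lemma sub_cols_ones_on_top:
  assumes "A \<in> carrier_mat m n" "set B \<subseteq> {..<n}"
  shows "sub_cols (ones_on_top A) B \<in> carrier_mat (Suc m) (length B)"
    and "\<And>i a. i < Suc m \<Longrightarrow> a < length B \<Longrightarrow>
      sub_cols (ones_on_top A) B $$ (i, a) = (if i = 0 then 1 else A $$ (i - 1, B ! a))"
  using assms by (auto simp: sub_cols_def ones_on_top_def mat_of_cols_index subset_iff)

lemma sub_cols_index:
  assumes "A \<in> carrier_mat m n" "set B \<subseteq> {..<n}"
  shows "sub_cols A B \<in> carrier_mat m (length B)"
    and "\<And>i a. i < m \<Longrightarrow> a < length B \<Longrightarrow> sub_cols A B $$ (i, a) = A $$ (i, B ! a)"
  using assms by (auto simp: sub_cols_def mat_of_cols_index subset_iff)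

lemma mult_mat_vec_index_sum:
  assumes "M \<in> carrier_mat p k" "c \<in> carrier_vec k" "i < p"
  shows "(M *\<^sub>v c) $ i = (\<Sum>a<k. M $$ (i, a) * c $ a)"
  using assms by (simp add: scalar_prod_def atLeast0LessThan)

lemma sub_cols_mult_vec:
  assumes "A \<in> carrier_mat m n" "set B \<subseteq> {..<n}" "c \<in> carrier_vec (length B)"
  shows "\<And>i. i < m \<Longrightarrow> (sub_cols A B *\<^sub>v c) $ i = (\<Sum>a<length B. A $$ (i, B ! a) * c $ a)"
    and "sub_cols A B *\<^sub>v c \<in> carrier_vec m"
proof -
  note S = sub_cols_index[OF assms(1,2)]
  show "(sub_cols A B *\<^sub>v c) $ i = (\<Sum>a<length B. A $$ (i, B ! a) * c $ a)" if "i < m" for i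
    using that S(2) by (simp add: mult_mat_vec_index_sum[OF S(1) assms(3) that])
  show "sub_cols A B *\<^sub>v c \<in> carrier_vec m" using S assms(3) by simp
qed

text \<open>The row of ones makes entry 0 of the lifted product the sum of the coefficients, and the
  other entries are those of the original product. Affine dependences are therefore exactly the
  kernel of the lifted submatrix.\<close>

lemma affinely_independent_iff_injective:
  assumes A: "A \<in> carrier_mat m n" and B: "set B \<subseteq> {..<n}"
  shows "affinely_independent_cols (sub_cols A B) \<longleftrightarrow>
    (\<forall>c \<in> carrier_vec (length B). sub_cols (ones_on_top A) B *\<^sub>v c = 0\<^sub>v (Suc m) \<longrightarrow> c = 0\<^sub>v (length B))"
proof -
  have "sub_cols (ones_on_top A) B *\<^sub>v c = 0\<^sub>v (Suc m) \<longleftrightarrow>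
      sub_cols A B *\<^sub>v c = 0\<^sub>v m \<and> (\<Sum>i<length B. c $ i) = 0" if c: "c \<in> carrier_vec (length B)" for c
  proof -
    note S = sub_cols_ones_on_top[OF A B]
    have *: "(sub_cols (ones_on_top A) B *\<^sub>v c) $ i =
        (if i = 0 then \<Sum>a<length B. c $ a else (sub_cols A B *\<^sub>v c) $ (i - 1))" if "i < Suc m" for i
    proof -
      have "(sub_cols (ones_on_top A) B *\<^sub>v c) $ i =
          (\<Sum>a<length B. (if i = 0 then 1 else A $$ (i - 1, B ! a)) * c $ a)"
        using that S(2) by (simp add: mult_mat_vec_index_sum[OF S(1) c that])
      then show ?thesis using that sub_cols_mult_vec(1)[OF A B c, of "i - 1"] by (cases "i = 0") simp_all
    qed
    have "sub_cols (ones_on_top A) B *\<^sub>v c = 0\<^sub>v (Suc m) \<longleftrightarrow>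
        (\<forall>i<Suc m. (sub_cols (ones_on_top A) B *\<^sub>v c) $ i = 0)"
      using S(1) by (auto simp: vec_eq_iff simp del: index_mult_mat_vec)
    also have "\<dots> \<longleftrightarrow> (\<Sum>a<length B. c $ a) = 0 \<and> (\<forall>i<m. (sub_cols A B *\<^sub>v c) $ i = 0)"
      unfolding All_less_Suc2 by (simp add: * del: index_mult_mat_vec)
    also have "(\<forall>i<m. (sub_cols A B *\<^sub>v c) $ i = 0) \<longleftrightarrow> sub_cols A B *\<^sub>v c = 0\<^sub>v m"
      using sub_cols_index[OF A B] by (auto simp: vec_eq_iff simp del: index_mult_mat_vec)
    finally show ?thesis by blast
  qed
  then show ?thesis
    using sub_cols_index(1)[OF A B] unfolding affinely_independent_cols_def by auto
qed

text \<open>A left inverse excludes a nontrivial kernel. In this way affine independence of the new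
  family is read off from its pseudoinverse.\<close>

lemma mp_inverse_on_injective:
  assumes M: "M \<in> carrier_mat p k" and X: "X \<in> carrier_mat k p"
    and mp: "mp_inverse_on p k (\<lambda>i a. M $$ (i, a)) (\<lambda>a i. X $$ (a, i))"
    and c: "c \<in> carrier_vec k" "M *\<^sub>v c = 0\<^sub>v p"
  shows "c = 0\<^sub>v k"
proof -
  have "X * M *\<^sub>v c = X *\<^sub>v (M *\<^sub>v c)" by (rule assoc_mult_mat_vec) (use M X c in auto)
  moreover have "X *\<^sub>v 0\<^sub>v p = 0\<^sub>v k" using X by (intro eq_vecI) auto
  ultimately show ?thesis using mp mp_inverse_on_iff[OF M X] c by simp
qed

section \<open>Cost semantics of programs\<close>

text \<open>A Hoare-style judgement. As \<open>exec\<close> is a total function, the existential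
  quantifiers name its only outcome; \<open>c\<close> is an upper bound, so branches of different
  cost can share one bound.\<close>

definition run :: "prog \<Rightarrow> state \<Rightarrow> nat \<Rightarrow> (state \<Rightarrow> bool) \<Rightarrow> bool" where
  "run p s c Q \<longleftrightarrow> (\<exists>s' t. exec p s = (s', t) \<and> t \<le> c \<and> Q s')"

lemma nats_set_nat [simp]:
  "nats (set_nat a i l v s) b i' l' = (if b = a \<and> i' = i \<and> l' = l then v else nats s b i' l')"
  by (simp add: set_nat_def)

lemma reals_set_real [simp]:
  "reals (set_real a i l v s) b i' l' = (if b = a \<and> i' = i \<and> l' = l then v else reals s b i' l')"
  by (simp add: set_real_def)

lemma reals_set_nat [simp]: "reals (set_nat a i l v s) = reals s"
  and nats_set_real [simp]: "nats (set_real a i l w s) = nats s"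
  by (simp_all add: set_nat_def set_real_def)

lemma run_Seq:
  assumes "run p s c1 (\<lambda>s'. run q s' c2 Q)" "c1 + c2 \<le> c"
  shows "run (Seq p q) s c Q"
proof -
  obtain s1 t1 where 1: "exec p s = (s1, t1)" "t1 \<le> c1" "run q s1 c2 Q"
    using assms(1) unfolding run_def by auto
  moreover obtain s2 t2 where "exec q s1 = (s2, t2)" "t2 \<le> c2" "Q s2"
    using 1(3) unfolding run_def by auto
  ultimately show ?thesis using assms(2) by (simp add: run_def)
qed

lemma run_NSet: "Q (set_nat a (neval e s) (neval f s) (neval g s) s) \<Longrightarrow> run (NSet a e f g) s c Q"
  by (simp add: run_def)

lemma run_RSet:
  "rcost g \<le> c \<Longrightarrow> Q (set_real a (neval e s) (neval f s) (reval g s) s) \<Longrightarrow> run (RSet a e f g) s c Q"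
  by (simp add: run_def)

lemma run_If:
  assumes "beval b s \<Longrightarrow> run p s c' Q" "\<not> beval b s \<Longrightarrow> run q s c' Q" "bcost b + c' \<le> c"
  shows "run (IfThenElse b p q) s c Q"
  using assms by (cases "beval b s") (auto simp: run_def)

lemma run_weaken: "run p s c Q \<Longrightarrow> (\<And>s'. Q s' \<Longrightarrow> R s') \<Longrightarrow> c \<le> c' \<Longrightarrow> run p s c' R"
  unfolding run_def by force

text \<open>Induction on the number of completed iterations. \<open>I i\<close> describes the state
  just before the counter is set to \<open>i\<close>, and the bound \<open>c\<close> is uniform over
  the iterations.\<close>

lemma run_For:
  assumes N: "neval e s = N" and init: "I 0 s"
    and step: "\<And>i s'. i < N \<Longrightarrow> I i s' \<Longrightarrow> run p (set_nat v 0 0 i s') c (I (Suc i))"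
    and fin: "\<And>s'. I N s' \<Longrightarrow> Q s'" and c: "N * c \<le> c'"
  shows "run (For v e p) s c' Q"
proof -
  let ?f = "\<lambda>i (s', t). let (s'', t') = exec p (set_nat v 0 0 i s') in (s'', t + t')"
  have "n \<le> N \<Longrightarrow> \<exists>s' t. fold ?f [0..<n] (s, 0) = (s', t) \<and> t \<le> n * c \<and> I n s'" for n
  proof (induction n)
    case (Suc n)
    then obtain s1 t1 where 1: "fold ?f [0..<n] (s, 0) = (s1, t1)" "t1 \<le> n * c" "I n s1" by auto
    obtain s2 t2 where "exec p (set_nat v 0 0 n s1) = (s2, t2)" "t2 \<le> c" "I (Suc n) s2"
      using step[OF _ 1(3)] Suc.prems unfolding run_def by auto
    then show ?case using 1 by simp
  qed (simp add: init)
  from this[of N] show ?thesis using N c fin by (fastforce simp: run_def)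
qed

section \<open>Frames, sums and loops that fill arrays\<close>

text \<open>The sets name the arrays that may have changed, as whole arrays. Stages of the program
  are separated by array names alone.\<close>

definition frame :: "string set \<Rightarrow> string set \<Rightarrow> state \<Rightarrow> state \<Rightarrow> bool" where
  "frame N R s s' \<longleftrightarrow> (\<forall>a i l. a \<notin> N \<longrightarrow> nats s' a i l = nats s a i l) \<and>
     (\<forall>a i l. a \<notin> R \<longrightarrow> reals s' a i l = reals s a i l)"

abbreviation nvar :: "string \<Rightarrow> nat_exp" where "nvar a \<equiv> NGet a (NConst 0) (NConst 0)"
abbreviation nelt :: "string \<Rightarrow> nat_exp \<Rightarrow> nat_exp" where "nelt a e \<equiv> NGet a e (NConst 0)"
abbreviation relt :: "string \<Rightarrow> nat_exp \<Rightarrow> real_exp" where "relt a e \<equiv> RGet a e (NConst 0)"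

definition accumulate :: "string \<Rightarrow> nat_exp \<Rightarrow> real_exp \<Rightarrow> string \<Rightarrow> nat_exp \<Rightarrow> real_exp \<Rightarrow> prog" where
  "accumulate a e init v N f =
     Seq (RSet a e (NConst 0) init)
       (For v N (RSet a e (NConst 0) (RAdd (relt a e) f)))"

text \<open>The hypothesis on \<open>f\<close> ranges over all states that agree with
  \<open>s\<close> outside the counter and the array \<open>a\<close>: the summand must not depend
  on the partial sums. Likewise the address \<open>e\<close> must not depend on the counter.\<close>

lemma run_accumulate:
  assumes N: "\<And>s'. nats s' = nats s \<Longrightarrow> neval N s' = n"
    and e: "\<And>s'. frame {v} UNIV s s' \<Longrightarrow> neval e s' = l"
    and init: "reval init s = b"
    and f: "\<And>i s'. i < n \<Longrightarrow> frame {v} {a} s s' \<Longrightarrow> nats s' v 0 0 = i \<Longrightarrow> reval f s' = F i"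
    and c: "rcost init + n * (rcost f + 1) \<le> c"
    and Q: "\<And>s'. frame {v} {a} s s' \<Longrightarrow>
        (\<And>i l'. reals s' a i l' = (if i = l \<and> l' = 0 then b + (\<Sum>i<n. F i) else reals s a i l')) \<Longrightarrow> Q s'"
  shows "run (accumulate a e init v N f) s c Q"
  unfolding accumulate_def
proof (rule run_Seq)
  let ?I = "\<lambda>m s'. frame {v} {a} s s' \<and>
     (\<forall>i l'. reals s' a i l' = (if i = l \<and> l' = 0 then b + (\<Sum>i<m. F i) else reals s a i l'))"
  have e0: "neval e s = l" using e[of s] by (simp add: frame_def)
  show "run (RSet a e (NConst 0) init) s (rcost init)
     (\<lambda>s'. run (For v N (RSet a e (NConst 0) (RAdd (relt a e) f))) s' (n * (rcost f + 1)) Q)"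
  proof (rule run_RSet, simp, rule run_For[where I = ?I])
    fix i s' assume i: "i < n" and I: "?I i s'"
    let ?s = "set_nat v 0 0 i s'"
    have fr: "frame {v} {a} s ?s" using I by (simp add: frame_def)
    then have "neval e ?s = l" by (intro e) (simp add: frame_def)
    moreover have "reval f ?s = F i" using i fr by (intro f) auto
    ultimately show "run (RSet a e (NConst 0) (RAdd (relt a e) f)) ?s (rcost f + 1) (?I (Suc i))"
      using I fr by (intro run_RSet) (auto simp: frame_def)
  qed (use Q in \<open>auto simp: N e0 init frame_def\<close>)
qed (rule c)

text \<open>The values come from one table \<open>F\<close> fixed in advance and only the set
  \<open>D\<close> of written cells varies, so the effects of successive iterations combine by
  uniting their cells.\<close>

definition writes :: "string set \<Rightarrow> string \<Rightarrow> (nat \<Rightarrow> nat \<Rightarrow> bool) \<Rightarrow> (nat \<Rightarrow> nat \<Rightarrow> real) \<Rightarrow> state \<Rightarrow> state \<Rightarrow> bool" where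
  "writes V a D F s s' \<longleftrightarrow> frame V {a} s s' \<and>
     (\<forall>i l. reals s' a i l = (if D i l then F i l else reals s a i l))"

lemma writes_index: "writes V a D F s s' \<Longrightarrow> reals s' a i l = (if D i l then F i l else reals s a i l)"
  and writes_frame: "writes V a D F s s' \<Longrightarrow> frame V {a} s s'"
  by (simp_all add: writes_def)

lemma frame_nats: "frame N R s s' \<Longrightarrow> a \<notin> N \<Longrightarrow> nats s' a i l = nats s a i l"
  and frame_reals: "frame N R s s' \<Longrightarrow> a \<notin> R \<Longrightarrow> reals s' a i l = reals s a i l"
  by (simp_all add: frame_def)

lemma frame_trans:
  assumes "frame N R s s'" "frame N' R' s' s''" "N \<union> N' \<subseteq> N''" "R \<union> R' \<subseteq> R''"
  shows "frame N'' R'' s s''"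
  using assms unfolding frame_def by (metis UnI1 UnI2 subsetD)

text \<open>All iterations write entries of the same table, so overlapping writes agree and the
  invariant after \<open>n\<close> iterations is \<open>writes\<close> for the union of the first
  \<open>n\<close> sets of cells.\<close>

lemma run_fill:
  assumes N: "neval e s = N" and v: "v \<in> V" and c: "N * c \<le> c'"
    and step: "\<And>i s1. i < N \<Longrightarrow> frame V {a} s s1 \<Longrightarrow> nats s1 v 0 0 = i \<Longrightarrow> run p s1 c (writes V a (D i) F s1)"
    and D: "\<And>i l. D' i l \<longleftrightarrow> (\<exists>b<N. D b i l)"
  shows "run (For v e p) s c' (writes V a D' F s)"
proof (rule run_For[where I = "\<lambda>n. writes V a (\<lambda>i l. \<exists>b<n. D b i l) F s"])
  fix i s' assume i: "i < N" and I: "writes V a (\<lambda>i' l. \<exists>b<i. D b i' l) F s s'"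
  have "run p (set_nat v 0 0 i s') c (writes V a (D i) F (set_nat v 0 0 i s'))"
    using i I v by (intro step) (auto simp: writes_def frame_def)
  then show "run p (set_nat v 0 0 i s') c (writes V a (\<lambda>i' l. \<exists>b<Suc i. D b i' l) F s)"
    by (rule run_weaken) (use I v in \<open>auto simp: writes_def frame_def less_Suc_eq\<close>)
qed (use N c D in \<open>auto simp: writes_def frame_def\<close>)

lemma run_RSet_writes:
  assumes "neval e s = i" "neval f s = l" "reval g s = F i l" "rcost g \<le> c"
  shows "run (RSet a e f g) s c (writes V a (\<lambda>i' l'. i' = i \<and> l' = l) F s)"
  using assms by (intro run_RSet) (auto simp: writes_def frame_def)

lemma run_fill_vec:
  assumes N: "neval e s = N" and f: "\<And>i s'. i < N \<Longrightarrow> frame {v} {a} s s' \<Longrightarrow> nats s' v 0 0 = i \<Longrightarrow> reval f s' = F i"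
    and c: "N * rcost f \<le> c"
  shows "run (For v e (RSet a (nvar v) (NConst 0) f)) s c (writes {v} a (\<lambda>i l. i < N \<and> l = 0) (\<lambda>i l. F i) s)"
  by (rule run_fill[where c = "rcost f" and N = N and D = "\<lambda>b i l. i = b \<and> l = 0"])
    (use assms in \<open>auto intro!: run_RSet_writes\<close>)

lemma writes_mono: "writes V a D F s s' \<Longrightarrow> V \<subseteq> V' \<Longrightarrow> writes V' a D F s s'"
  by (auto simp: writes_def frame_def)

lemma run_fill_mat:
  assumes uv: "u \<noteq> v" and e: "neval e s = N" and f: "\<And>s'. frame {u, v} {a} s s' \<Longrightarrow> neval f s' = n"
    and step: "\<And>i l s'. i < N \<Longrightarrow> l < n \<Longrightarrow> frame {u, v} {a} s s' \<Longrightarrow> nats s' u 0 0 = i \<Longrightarrow> nats s' v 0 0 = l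
      \<Longrightarrow> run p s' c (writes {} a (\<lambda>i' l'. i' = i \<and> l' = l) F s')"
    and c: "N * (n * c) \<le> c'"
  shows "run (For u e (For v f p)) s c' (writes {u, v} a (\<lambda>i l. i < N \<and> l < n) F s)"
proof (rule run_fill[where N = N and c = "n * c" and D = "\<lambda>b i l. i = b \<and> l < n"])
  fix i s1 assume i: "i < N" and s1: "frame {u, v} {a} s s1" "nats s1 u 0 0 = i"
  have "run (For v f p) s1 (n * c) (writes {v} a (\<lambda>i' l. i' = i \<and> l < n) F s1)"
  proof (rule run_fill[where N = n and c = c and D = "\<lambda>b i' l. i' = i \<and> l = b"])
    fix l s2 assume l: "l < n" and s2: "frame {v} {a} s1 s2" "nats s2 v 0 0 = l"
    have "frame {u, v} {a} s s2" "nats s2 u 0 0 = i" using s1 s2 uv by (simp_all add: frame_def)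
    then have "run p s2 c (writes {} a (\<lambda>i' l'. i' = i \<and> l' = l) F s2)" using i l s2 by (intro step)
    then show "run p s2 c (writes {v} a (\<lambda>i' l'. i' = i \<and> l' = l) F s2)"
      by (rule run_weaken) (auto intro: writes_mono)
  qed (use f s1 in auto)
  then show "run (For v f p) s1 (n * c) (writes {u, v} a (\<lambda>i' l. i' = i \<and> l < n) F s1)"
    by (rule run_weaken) (auto intro: writes_mono)
qed (use e c in auto)

lemma run_accumulate_scalar:
  assumes N: "\<And>s'. nats s' = nats s \<Longrightarrow> neval N s' = n"
    and f: "\<And>i s'. i < n \<Longrightarrow> frame {v} {a} s s' \<Longrightarrow> nats s' v 0 0 = i \<Longrightarrow> reval f s' = F i"
  shows "run (accumulate a (NConst 0) RZero v N f) s (n * (rcost f + 1))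
     (writes {v} a (\<lambda>i l. i = 0 \<and> l = 0) (\<lambda>i l. \<Sum>i<n. F i) s)"
  by (rule run_accumulate[where n = n and b = 0 and l = 0 and F = F])
    (use assms in \<open>simp_all add: writes_def\<close>)

text \<open>With \<open>f\<close> a product of a matrix entry and a vector entry, this is a
  matrix-vector product added to the vector given by \<open>init\<close>.\<close>

definition dots :: "string \<Rightarrow> string \<Rightarrow> nat_exp \<Rightarrow> real_exp \<Rightarrow> string \<Rightarrow> nat_exp \<Rightarrow> real_exp \<Rightarrow> prog" where
  "dots a u K init v N f = For u K (accumulate a (nvar u) init v N f)"

lemma run_dots:
  assumes uv: "u \<noteq> v" and K: "neval K s = k"
    and N: "\<And>s'. frame {u, v} {a} s s' \<Longrightarrow> neval N s' = n"
    and init: "\<And>i s'. i < k \<Longrightarrow> frame {u, v} {a} s s' \<Longrightarrow> nats s' u 0 0 = i \<Longrightarrow> reval init s' = b i"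
    and f: "\<And>i l s'. i < k \<Longrightarrow> l < n \<Longrightarrow> frame {u, v} {a} s s' \<Longrightarrow> nats s' u 0 0 = i \<Longrightarrow> nats s' v 0 0 = l
        \<Longrightarrow> reval f s' = F i l"
    and c: "k * (rcost init + n * (rcost f + 1)) \<le> c"
  shows "run (dots a u K init v N f) s c
     (writes {u, v} a (\<lambda>i l. i < k \<and> l = 0) (\<lambda>i l. b i + (\<Sum>l<n. F i l)) s)"
  unfolding dots_def
proof (rule run_fill[where N = k and c = "rcost init + n * (rcost f + 1)" and D = "\<lambda>b i l. i = b \<and> l = 0"])
  fix i s1 assume i: "i < k" and s1: "frame {u, v} {a} s s1" "nats s1 u 0 0 = i"
  have fr: "frame {u, v} {a} s s'" if "frame {v} {a} s1 s'" for s'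
    using s1 that by (auto simp: frame_def)
  show "run (accumulate a (nvar u) init v N f) s1 (rcost init + n * (rcost f + 1))
         (writes {u, v} a (\<lambda>i' l. i' = i \<and> l = 0) (\<lambda>i l. b i + (\<Sum>l<n. F i l)) s1)"
  proof (rule run_accumulate[where n = n and l = i and b = "b i" and F = "F i"])
    show "neval N s' = n" if "nats s' = nats s1" for s'
    proof -
      \<comment> \<open>Index expressions never read real arrays, so agreement of the natural-number
        arrays suffices.\<close>
      have "neval e s' = neval e s1" for e using that by (induction e) auto
      then show ?thesis using N s1 by auto
    qed
    show "neval (nvar u) s' = i" if "frame {v} UNIV s1 s'" for s'
      using that s1 uv by (simp add: frame_def)
    show "reval init s1 = b i" using i s1 by (intro init)
    show "reval f s' = F i l" if "l < n" "frame {v} {a} s1 s'" "nats s' v 0 0 = l" for l s'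
      using i that fr[OF that(2)] s1 uv by (intro f) (auto simp: frame_def)
  qed (auto simp: writes_def frame_def)
qed (use K c in auto)

section \<open>The basis update program\<close>

text \<open>Only data movement and the constant 1 occur, so the cost is 0. This matters because all
  \<open>n\<close> columns are lifted and \<open>n\<close> is not bounded in terms of
  \<open>m\<close>.\<close>

definition lift_matrix :: prog where
  "lift_matrix = For ''i'' (nvar ''q'') (For ''l'' (nvar ''n'')
       (IfThenElse (NEq (nvar ''i'') (NConst 0)) (RSet ''T'' (nvar ''i'') (nvar ''l'') ROne)
         (RSet ''T'' (nvar ''i'') (nvar ''l'') (RGet ''A'' (NSub (nvar ''i'') (NConst 1)) (nvar ''l'')))))"

definition lift_vector :: prog where
  "lift_vector = For ''i'' (nvar ''q'')
       (IfThenElse (NEq (nvar ''i'') (NConst 0)) (RSet ''w'' (nvar ''i'') (NConst 0) ROne)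
         (RSet ''w'' (nvar ''i'') (NConst 0) (relt ''z'' (NSub (nvar ''i'') (NConst 1)))))"

lemma run_lift_matrix:
  assumes q: "nats s ''q'' 0 0 = q" and n: "nats s ''n'' 0 0 = n"
  shows "run lift_matrix s 0 (writes {''i'', ''l''} ''T'' (\<lambda>i l. i < q \<and> l < n)
     (\<lambda>i l. if i = 0 then 1 else reals s ''A'' (i - 1) l) s)"
  unfolding lift_matrix_def
proof (rule run_fill_mat[where c = 0])
  fix i l s' assume s': "frame {''i'', ''l''} {''T''} s s'" "nats s' ''i'' 0 0 = i" "nats s' ''l'' 0 0 = l"
  show "run (IfThenElse (NEq (nvar ''i'') (NConst 0)) (RSet ''T'' (nvar ''i'') (nvar ''l'') ROne)
         (RSet ''T'' (nvar ''i'') (nvar ''l'') (RGet ''A'' (NSub (nvar ''i'') (NConst 1)) (nvar ''l'')))) s' 0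
      (writes {} ''T'' (\<lambda>i' l'. i' = i \<and> l' = l)
         (\<lambda>i l. if i = 0 then 1 else reals s ''A'' (i - 1) l) s')"
    using s' by (intro run_If[where c' = 0] run_RSet_writes) (simp_all add: frame_def)
qed (use q n in \<open>simp_all add: frame_def\<close>)

lemma run_lift_vector:
  assumes q: "nats s ''q'' 0 0 = q"
  shows "run lift_vector s 0 (writes {''i''} ''w'' (\<lambda>i l. i < q \<and> l = 0)
     (\<lambda>i l. if i = 0 then 1 else reals s ''z'' (i - 1) 0) s)"
  unfolding lift_vector_def
proof (rule run_fill[where N = q and c = 0 and D = "\<lambda>b i l. i = b \<and> l = 0"])
  fix i s' assume s': "frame {''i''} {''w''} s s'" "nats s' ''i'' 0 0 = i"
  show "run (IfThenElse (NEq (nvar ''i'') (NConst 0)) (RSet ''w'' (nvar ''i'') (NConst 0) ROne)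
         (RSet ''w'' (nvar ''i'') (NConst 0) (relt ''z'' (NSub (nvar ''i'') (NConst 1))))) s' 0
      (writes {''i''} ''w'' (\<lambda>i' l'. i' = i \<and> l' = 0) (\<lambda>i l. if i = 0 then 1 else reals s ''z'' (i - 1) 0) s')"
    using s' by (intro run_If[where c' = 0] run_RSet_writes) (simp_all add: frame_def)
qed (use q in auto)

text \<open>\<open>q\<close> is the number of rows of the lifted matrix. The residual is accumulated
  with coefficients \<open>0 - d a\<close>, since \<open>accumulate\<close> can only add.\<close>

definition solve :: prog where
  "solve = Seq (NSet ''q'' (NConst 0) (NConst 0) (NAdd (nvar ''m'') (NConst 1)))
   (Seq lift_matrix (Seq lift_vector
   (Seq (dots ''d'' ''a'' (nvar ''k'') RZero ''i'' (nvar ''q'')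
          (RMul (RGet ''P'' (nvar ''a'') (nvar ''i'')) (RGet ''T'' (nvar ''i'') (nvar ''j''))))
   (Seq (dots ''y'' ''a'' (nvar ''k'') RZero ''i'' (nvar ''q'')
          (RMul (RGet ''P'' (nvar ''a'') (nvar ''i'')) (relt ''w'' (nvar ''i''))))
   (Seq (dots ''r'' ''i'' (nvar ''q'') (RGet ''T'' (nvar ''i'') (nvar ''j'')) ''a'' (nvar ''k'')
          (RMul (RGet ''T'' (nvar ''i'') (nelt ''B'' (nvar ''a''))) (RSub RZero (relt ''d'' (nvar ''a'')))))
   (accumulate ''rho'' (NConst 0) RZero ''i'' (nvar ''q'') (RMul (relt ''r'' (nvar ''i'')) (relt ''r'' (nvar ''i'')))))))))"

lemma exec_SeqI: "exec p s = (s', t) \<Longrightarrow> exec q s' = (s'', t') \<Longrightarrow> exec (Seq p q) s = (s'', t + t')"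
  by simp

lemma run_obtain:
  assumes "run p s c Q"
  obtains s' t where "exec p s = (s', t)" "t \<le> c" "Q s'"
  using assms unfolding run_def by blast

text \<open>The 7 consists of two operations per matrix entry for each of \<open>d\<close> and
  \<open>y\<close> and three for \<open>r\<close>, whose terms contain the extra subtraction from 0.
  The squared norm \<open>rho\<close> takes two operations per row.\<close>

lemma run_solve:
  assumes nats: "nats s ''m'' 0 0 = m" "nats s ''n'' 0 0 = n" "nats s ''k'' 0 0 = k" "nats s ''j'' 0 0 = j"
    and B: "\<And>a. a < k \<Longrightarrow> nats s ''B'' a 0 = B ! a" "\<And>a. a < k \<Longrightarrow> B ! a < n" and j: "j < n"
    and A: "\<And>i l. i < m \<Longrightarrow> l < n \<Longrightarrow> reals s ''A'' i l = A $$ (i, l)"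
    and z: "\<And>i. i < m \<Longrightarrow> reals s ''z'' i 0 = z $ i"
    and P: "\<And>a i. a < k \<Longrightarrow> i < Suc m \<Longrightarrow> reals s ''P'' a i = P a i"
  defines "T \<equiv> \<lambda>i l. if i = 0 then 1 else A $$ (i - 1, l)"
    and "w \<equiv> \<lambda>i. if i = 0 then 1 else z $ (i - 1)"
  defines "d \<equiv> \<lambda>a. \<Sum>i<Suc m. P a i * T i j"
    and "y \<equiv> \<lambda>a. \<Sum>i<Suc m. P a i * w i"
  defines "r \<equiv> \<lambda>i. T i j - (\<Sum>a<k. T i (B ! a) * d a)"
  shows "run solve s (7 * (k * Suc m) + 2 * Suc m)
    (\<lambda>s'. frame {''q'', ''i'', ''l'', ''a''} {''T'', ''w'', ''d'', ''y'', ''r'', ''rho''} s s' \<and>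
      nats s' ''q'' 0 0 = Suc m \<and> (\<forall>i<Suc m. reals s' ''w'' i 0 = w i) \<and>
      (\<forall>a<k. reals s' ''d'' a 0 = d a) \<and> (\<forall>a<k. reals s' ''y'' a 0 = y a) \<and>
      (\<forall>i<Suc m. reals s' ''r'' i 0 = r i) \<and> reals s' ''rho'' 0 0 = (\<Sum>i<Suc m. r i * r i))"
proof -
  define s1 where "s1 = set_nat ''q'' 0 0 (Suc m) s"
  have e1: "exec (NSet ''q'' (NConst 0) (NConst 0) (NAdd (nvar ''m'') (NConst 1))) s = (s1, 0)"
    using nats by (simp add: s1_def)
  have q1: "nats s1 ''q'' 0 0 = Suc m" "nats s1 ''n'' 0 0 = n" using nats by (simp_all add: s1_def)
  obtain s2 t2 where s2: "exec lift_matrix s1 = (s2, t2)" "t2 \<le> 0"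
      "writes {''i'', ''l''} ''T'' (\<lambda>i l. i < Suc m \<and> l < n) (\<lambda>i l. if i = 0 then 1 else reals s1 ''A'' (i - 1) l) s1 s2"
    using run_obtain[OF run_lift_matrix[OF q1]] .
  have f2: "frame {''q'', ''i'', ''l''} {''T''} s s2" and q2: "nats s2 ''q'' 0 0 = Suc m"
    and T2: "\<And>i l. i < Suc m \<Longrightarrow> l < n \<Longrightarrow> reals s2 ''T'' i l = T i l"
  proof -
    have "frame {''q''} {} s s1" by (simp add: s1_def frame_def)
    then show "frame {''q'', ''i'', ''l''} {''T''} s s2"
      by (rule frame_trans[OF _ writes_frame[OF s2(3)]]) auto
    show "nats s2 ''q'' 0 0 = Suc m" by (simp add: frame_nats[OF writes_frame[OF s2(3)]] q1)
    show "reals s2 ''T'' i l = T i l" if "i < Suc m" "l < n" for i l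
      using that A by (simp add: writes_index[OF s2(3)] T_def s1_def)
  qed
  obtain s3 t3 where s3: "exec lift_vector s2 = (s3, t3)" "t3 \<le> 0"
      "writes {''i''} ''w'' (\<lambda>i l. i < Suc m \<and> l = 0) (\<lambda>i l. if i = 0 then 1 else reals s2 ''z'' (i - 1) 0) s2 s3"
    using run_obtain[OF run_lift_vector[OF q2]] .
  have f3: "frame {''q'', ''i'', ''l''} {''T'', ''w''} s s3" and q3: "nats s3 ''q'' 0 0 = Suc m"
    and T3: "\<And>i l. i < Suc m \<Longrightarrow> l < n \<Longrightarrow> reals s3 ''T'' i l = T i l"
    and w3: "\<And>i. i < Suc m \<Longrightarrow> reals s3 ''w'' i 0 = w i"
  proof -
    note fr = writes_frame[OF s3(3)]
    show "frame {''q'', ''i'', ''l''} {''T'', ''w''} s s3" by (rule frame_trans[OF f2 fr]) auto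
    show "nats s3 ''q'' 0 0 = Suc m" by (simp add: frame_nats[OF fr] q2)
    show "reals s3 ''T'' i l = T i l" if "i < Suc m" "l < n" for i l
      using that by (simp add: frame_reals[OF fr] T2)
    show "reals s3 ''w'' i 0 = w i" if "i < Suc m" for i
      using that z by (simp add: writes_index[OF s3(3)] frame_reals[OF f2] w_def)
  qed
  have in3: "nats s3 ''k'' 0 0 = k" "nats s3 ''j'' 0 0 = j"
    "\<And>a i. a < k \<Longrightarrow> i < Suc m \<Longrightarrow> reals s3 ''P'' a i = P a i" "\<And>a. a < k \<Longrightarrow> nats s3 ''B'' a 0 = B ! a"
    using nats P B by (simp_all add: frame_nats[OF f3] frame_reals[OF f3])
  have "run (dots ''d'' ''a'' (nvar ''k'') RZero ''i'' (nvar ''q'')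
          (RMul (RGet ''P'' (nvar ''a'') (nvar ''i'')) (RGet ''T'' (nvar ''i'') (nvar ''j'')))) s3
      (2 * (k * Suc m)) (writes {''a'', ''i''} ''d'' (\<lambda>a l. a < k \<and> l = 0) (\<lambda>a l. 0 + (\<Sum>i<Suc m. P a i * T i j)) s3)"
    by (rule run_dots) (use in3 q3 T3 j in \<open>simp_all add: frame_def\<close>)
  from run_obtain[OF this] obtain s4 t4 where s4: "exec (dots ''d'' ''a'' (nvar ''k'') RZero ''i'' (nvar ''q'')
          (RMul (RGet ''P'' (nvar ''a'') (nvar ''i'')) (RGet ''T'' (nvar ''i'') (nvar ''j'')))) s3 = (s4, t4)"
      "t4 \<le> 2 * (k * Suc m)"
      "writes {''a'', ''i''} ''d'' (\<lambda>a l. a < k \<and> l = 0) (\<lambda>a l. 0 + (\<Sum>i<Suc m. P a i * T i j)) s3 s4" .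
  have f4: "frame {''a'', ''i''} {''d''} s3 s4" and d4: "\<And>a. a < k \<Longrightarrow> reals s4 ''d'' a 0 = d a"
    using s4(3) by (simp_all add: writes_def d_def)
  have in4: "nats s4 ''q'' 0 0 = Suc m" "nats s4 ''k'' 0 0 = k"
    "\<And>a i. a < k \<Longrightarrow> i < Suc m \<Longrightarrow> reals s4 ''P'' a i = P a i" "\<And>i. i < Suc m \<Longrightarrow> reals s4 ''w'' i 0 = w i"
    using in3 q3 w3 by (simp_all add: frame_nats[OF f4] frame_reals[OF f4])
  have "run (dots ''y'' ''a'' (nvar ''k'') RZero ''i'' (nvar ''q'')
          (RMul (RGet ''P'' (nvar ''a'') (nvar ''i'')) (relt ''w'' (nvar ''i'')))) s4
      (2 * (k * Suc m)) (writes {''a'', ''i''} ''y'' (\<lambda>a l. a < k \<and> l = 0) (\<lambda>a l. 0 + (\<Sum>i<Suc m. P a i * w i)) s4)"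
    by (rule run_dots) (use in4 in \<open>simp_all add: frame_def\<close>)
  from run_obtain[OF this] obtain s5 t5 where s5: "exec (dots ''y'' ''a'' (nvar ''k'') RZero ''i'' (nvar ''q'')
          (RMul (RGet ''P'' (nvar ''a'') (nvar ''i'')) (relt ''w'' (nvar ''i'')))) s4 = (s5, t5)"
      "t5 \<le> 2 * (k * Suc m)"
      "writes {''a'', ''i''} ''y'' (\<lambda>a l. a < k \<and> l = 0) (\<lambda>a l. 0 + (\<Sum>i<Suc m. P a i * w i)) s4 s5" .
  have f5: "frame {''a'', ''i''} {''d'', ''y''} s3 s5" and d5: "\<And>a. a < k \<Longrightarrow> reals s5 ''d'' a 0 = d a"
    and y5: "\<And>a. a < k \<Longrightarrow> reals s5 ''y'' a 0 = y a"
  proof -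
    note fr = writes_frame[OF s5(3)]
    show "frame {''a'', ''i''} {''d'', ''y''} s3 s5" by (rule frame_trans[OF f4 fr]) auto
    show "reals s5 ''d'' a 0 = d a" if "a < k" for a using that by (simp add: frame_reals[OF fr] d4)
    show "reals s5 ''y'' a 0 = y a" if "a < k" for a using that by (simp add: writes_index[OF s5(3)] y_def)
  qed
  have in5: "nats s5 ''q'' 0 0 = Suc m" "nats s5 ''k'' 0 0 = k" "nats s5 ''j'' 0 0 = j"
    "\<And>a. a < k \<Longrightarrow> nats s5 ''B'' a 0 = B ! a"
    "\<And>i l. i < Suc m \<Longrightarrow> l < n \<Longrightarrow> reals s5 ''T'' i l = T i l"
    using in3 q3 T3 by (simp_all add: frame_nats[OF f5] frame_reals[OF f5])
  have "run (dots ''r'' ''i'' (nvar ''q'') (RGet ''T'' (nvar ''i'') (nvar ''j'')) ''a'' (nvar ''k'')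
          (RMul (RGet ''T'' (nvar ''i'') (nelt ''B'' (nvar ''a''))) (RSub RZero (relt ''d'' (nvar ''a''))))) s5
      (3 * (k * Suc m)) (writes {''i'', ''a''} ''r'' (\<lambda>i l. i < Suc m \<and> l = 0)
        (\<lambda>i l. T i j + (\<Sum>a<k. T i (B ! a) * (0 - d a))) s5)"
    by (rule run_dots) (use in5 B(2) j d5 in \<open>simp_all add: frame_def\<close>)
  from run_obtain[OF this] obtain s6 t6 where s6: "exec (dots ''r'' ''i'' (nvar ''q'') (RGet ''T'' (nvar ''i'') (nvar ''j'')) ''a'' (nvar ''k'')
          (RMul (RGet ''T'' (nvar ''i'') (nelt ''B'' (nvar ''a''))) (RSub RZero (relt ''d'' (nvar ''a''))))) s5 = (s6, t6)"
      "t6 \<le> 3 * (k * Suc m)"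
      "writes {''i'', ''a''} ''r'' (\<lambda>i l. i < Suc m \<and> l = 0)
        (\<lambda>i l. T i j + (\<Sum>a<k. T i (B ! a) * (0 - d a))) s5 s6" .
  have f6: "frame {''a'', ''i''} {''d'', ''y'', ''r''} s3 s6" and d6: "\<And>a. a < k \<Longrightarrow> reals s6 ''d'' a 0 = d a"
    and y6: "\<And>a. a < k \<Longrightarrow> reals s6 ''y'' a 0 = y a" and r6: "\<And>i. i < Suc m \<Longrightarrow> reals s6 ''r'' i 0 = r i"
  proof -
    note fr = writes_frame[OF s6(3)]
    show "frame {''a'', ''i''} {''d'', ''y'', ''r''} s3 s6" by (rule frame_trans[OF f5 fr]) auto
    show "reals s6 ''d'' a 0 = d a" if "a < k" for a using that by (simp add: frame_reals[OF fr] d5)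
    show "reals s6 ''y'' a 0 = y a" if "a < k" for a using that by (simp add: frame_reals[OF fr] y5)
    show "reals s6 ''r'' i 0 = r i" if "i < Suc m" for i
      using that by (simp add: writes_index[OF s6(3)] r_def sum_negf)
  qed
  have q6: "nats s6 ''q'' 0 0 = Suc m" using q3 by (simp add: frame_nats[OF f6])
  obtain s7 t7 where s7: "exec (accumulate ''rho'' (NConst 0) RZero ''i'' (nvar ''q'') (RMul (relt ''r'' (nvar ''i'')) (relt ''r'' (nvar ''i'')))) s6 = (s7, t7)"
      "t7 \<le> 2 * Suc m" and f7: "frame {''i''} {''rho''} s6 s7" and rho7: "reals s7 ''rho'' 0 0 = (\<Sum>i<Suc m. r i * r i)"
  proof -
    have "run (accumulate ''rho'' (NConst 0) RZero ''i'' (nvar ''q'') (RMul (relt ''r'' (nvar ''i'')) (relt ''r'' (nvar ''i'')))) s6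
       (Suc m * (rcost (RMul (relt ''r'' (nvar ''i'')) (relt ''r'' (nvar ''i''))) + 1))
       (writes {''i''} ''rho'' (\<lambda>i l. i = 0 \<and> l = 0) (\<lambda>i l. \<Sum>i<Suc m. r i * r i) s6)"
    proof (rule run_accumulate_scalar)
      show "reval (RMul (relt ''r'' (nvar ''i'')) (relt ''r'' (nvar ''i''))) s' = r i * r i"
        if "i < Suc m" "frame {''i''} {''rho''} s6 s'" "nats s' ''i'' 0 0 = i" for i s'
        using that(1,3) r6 by (simp add: frame_reals[OF that(2)])
    qed (simp_all add: q6)
    from run_obtain[OF this] obtain s7 t7 where
      1: "exec (accumulate ''rho'' (NConst 0) RZero ''i'' (nvar ''q'') (RMul (relt ''r'' (nvar ''i'')) (relt ''r'' (nvar ''i'')))) s6 = (s7, t7)"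
      and 2: "t7 \<le> Suc m * (rcost (RMul (relt ''r'' (nvar ''i'')) (relt ''r'' (nvar ''i''))) + 1)"
      and 3: "writes {''i''} ''rho'' (\<lambda>i l. i = 0 \<and> l = 0) (\<lambda>i l. \<Sum>i<Suc m. r i * r i) s6 s7" .
    show ?thesis
      by (rule that[OF 1 _ writes_frame[OF 3]]) (use 2 in \<open>simp_all add: writes_index[OF 3]\<close>)
  qed
  have "exec solve s = (s7, 0 + (t2 + (t3 + (t4 + (t5 + (t6 + t7))))))"
    unfolding solve_def 
    by (rule exec_SeqI[OF e1 exec_SeqI[OF s2(1) exec_SeqI[OF s3(1) exec_SeqI[OF s4(1)
          exec_SeqI[OF s5(1) exec_SeqI[OF s6(1) s7(1)]]]]]])
  moreover have "0 + (t2 + (t3 + (t4 + (t5 + (t6 + t7))))) \<le> 7 * (k * Suc m) + 2 * Suc m"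
    using s2(2) s3(2) s4(2) s5(2) s6(2) s7(2) by linarith
  moreover have f: "frame {''a'', ''i''} {''d'', ''y'', ''r'', ''rho''} s3 s7"
    by (rule frame_trans[OF f6 f7]) auto
  moreover have "frame {''q'', ''i'', ''l'', ''a''} {''T'', ''w'', ''d'', ''y'', ''r'', ''rho''} s s7"
    by (rule frame_trans[OF f3 f]) auto
  moreover have "nats s7 ''q'' 0 0 = Suc m" "\<And>i. i < Suc m \<Longrightarrow> reals s7 ''w'' i 0 = w i"
    using q3 w3 by (simp_all add: frame_nats[OF f] frame_reals[OF f])
  moreover have "\<And>a. a < k \<Longrightarrow> reals s7 ''d'' a 0 = d a" "\<And>a. a < k \<Longrightarrow> reals s7 ''y'' a 0 = y a"
    "\<And>i. i < Suc m \<Longrightarrow> reals s7 ''r'' i 0 = r i"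
    using d6 y6 r6 by (simp_all add: frame_reals[OF f7])
  ultimately show ?thesis using rho7 unfolding run_def by blast
qed

section \<open>Ratio test and choice of the pivot position\<close>

text \<open>\<open>L = k\<close> serves as the sentinel for no candidate found yet. The nested
  negations express an implication: the quotients decide only once \<open>L < k\<close>.\<close>

definition ratio_test :: prog where
  "ratio_test = For ''a'' (nvar ''k'')
     (IfThenElse (BAnd (RLess RZero (relt ''d'' (nvar ''a'')))
          (BNot (BAnd (NLess (nvar ''L'') (nvar ''k''))
            (BNot (RLess (RDiv (relt ''y'' (nvar ''a'')) (relt ''d'' (nvar ''a'')))
                         (RDiv (relt ''y'' (nvar ''L'')) (relt ''d'' (nvar ''L''))))))))
       (NSet ''L'' (NConst 0) (NConst 0) (nvar ''a'')) Skip)"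

text \<open>The loop invariant after the first \<open>n\<close> positions. It forces
  \<open>l < k\<close> as soon as one of them has a positive \<open>d\<close>, and otherwise admits
  the sentinel.\<close>

definition ratio_min :: "nat \<Rightarrow> (nat \<Rightarrow> real) \<Rightarrow> (nat \<Rightarrow> real) \<Rightarrow> nat \<Rightarrow> nat \<Rightarrow> bool" where
  "ratio_min k d y n l \<longleftrightarrow> (l < k \<longrightarrow> 0 < d l) \<and> (\<forall>b<n. 0 < d b \<longrightarrow> l < k \<and> y l / d l \<le> y b / d b)"

lemma ratio_min_Suc:
  assumes "ratio_min k d y n l" "n < k"
  shows "ratio_min k d y (Suc n) (if 0 < d n \<and> (l < k \<longrightarrow> y n / d n < y l / d l) then n else l)"
proof (cases "0 < d n \<and> (l < k \<longrightarrow> y n / d n < y l / d l)")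
  case True
  have "y n / d n \<le> y b / d b" if "b < Suc n" "0 < d b" for b
  proof (cases "b = n")
    case False
    then have "b < n" using that by simp
    then have "l < k" "y l / d l \<le> y b / d b" using assms(1) that by (auto simp: ratio_min_def)
    then show ?thesis using True by linarith
  qed simp
  then show ?thesis using True assms(2) by (simp add: ratio_min_def)
next
  case False
  then have "l < k \<and> y l / d l \<le> y b / d b" if "b < Suc n" "0 < d b" for b
    using that assms(1) by (elim less_SucE) (auto simp: ratio_min_def not_less)
  moreover have "l < k \<longrightarrow> 0 < d l" using assms(1) by (simp add: ratio_min_def)
  ultimately show ?thesis unfolding if_not_P[OF False] by (simp add: ratio_min_def)
qed

text \<open>Each position costs 4: the comparison with 0, two divisions and the comparison of the
  quotients. The cost of a conjunction always counts both sides.\<close>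

lemma run_ratio_test:
  assumes k: "nats s ''k'' 0 0 = k" "nats s ''L'' 0 0 = k"
    and d: "\<And>a. a < k \<Longrightarrow> reals s ''d'' a 0 = d a" and y: "\<And>a. a < k \<Longrightarrow> reals s ''y'' a 0 = y a"
  shows "run ratio_test s (k * 4) (\<lambda>s'. frame {''a'', ''L''} {} s s' \<and> ratio_min k d y k (nats s' ''L'' 0 0))"
  unfolding ratio_test_def
proof (rule run_For[where N = k and c = 4 and
      I = "\<lambda>n s'. frame {''a'', ''L''} {} s s' \<and> ratio_min k d y n (nats s' ''L'' 0 0)"])
  fix i s' assume i: "i < k" and I: "frame {''a'', ''L''} {} s s' \<and> ratio_min k d y i (nats s' ''L'' 0 0)"
  let ?s = "set_nat ''a'' 0 0 i s'" and ?L = "nats s' ''L'' 0 0"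
  let ?b = "BAnd (RLess RZero (relt ''d'' (nvar ''a'')))
          (BNot (BAnd (NLess (nvar ''L'') (nvar ''k''))
            (BNot (RLess (RDiv (relt ''y'' (nvar ''a'')) (relt ''d'' (nvar ''a'')))
                         (RDiv (relt ''y'' (nvar ''L'')) (relt ''d'' (nvar ''L'')))))))"
  have *: "nats s' ''k'' 0 0 = k" "\<And>a. a < k \<Longrightarrow> reals s' ''d'' a 0 = d a" "\<And>a. a < k \<Longrightarrow> reals s' ''y'' a 0 = y a"
    using I k d y by (simp_all add: frame_def)
  have b: "beval ?b ?s \<longleftrightarrow> 0 < d i \<and> (?L < k \<longrightarrow> y i / d i < y ?L / d ?L)"
    using i by (cases "?L < k") (simp_all add: *)
  have fr: "frame {''a'', ''L''} {} s ?s" using I by (simp add: frame_def)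
  note step = ratio_min_Suc[OF conjunct2[OF I] i, folded b]
  show "run (IfThenElse ?b (NSet ''L'' (NConst 0) (NConst 0) (nvar ''a'')) Skip) ?s 4
     (\<lambda>s'. frame {''a'', ''L''} {} s s' \<and> ratio_min k d y (Suc i) (nats s' ''L'' 0 0))"
  proof (rule run_If[where c' = 0])
    assume "beval ?b ?s"
    then have "ratio_min k d y (Suc i) i" using step by (simp only: if_True)
    then show "run (NSet ''L'' (NConst 0) (NConst 0) (nvar ''a'')) ?s 0
      (\<lambda>s'. frame {''a'', ''L''} {} s s' \<and> ratio_min k d y (Suc i) (nats s' ''L'' 0 0))"
      by (intro run_NSet) (use fr in \<open>simp add: frame_def\<close>)
  next
    assume "\<not> beval ?b ?s"
    then have "ratio_min k d y (Suc i) ?L" using step by (simp only: if_False)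
    then show "run Skip ?s 0
      (\<lambda>s'. frame {''a'', ''L''} {} s s' \<and> ratio_min k d y (Suc i) (nats s' ''L'' 0 0))"
      using fr by (simp add: run_def)
  qed simp
qed (use k in \<open>auto simp: frame_def ratio_min_def\<close>)

text \<open>Appending and exchanging leave the same interface behind: the pivot position in
  \<open>L\<close>, the new length in \<open>k_out\<close> and the new row of the pseudoinverse in
  \<open>g\<close>. The later stages need no case distinction.\<close>

definition append_column :: prog where
  "append_column = Seq (NSet ''L'' (NConst 0) (NConst 0) (nvar ''k''))
     (Seq (NSet ''k_out'' (NConst 0) (NConst 0) (NAdd (nvar ''k'') (NConst 1)))
     (For ''i'' (nvar ''q'') (RSet ''g'' (nvar ''i'') (NConst 0) (RDiv (relt ''r'' (nvar ''i'')) (relt ''rho'' (NConst 0))))))"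

definition exchange_column :: prog where
  "exchange_column = Seq (NSet ''L'' (NConst 0) (NConst 0) (nvar ''k''))
     (Seq (NSet ''k_out'' (NConst 0) (NConst 0) (nvar ''k''))
     (Seq ratio_test
     (For ''i'' (nvar ''q'') (RSet ''g'' (nvar ''i'') (NConst 0)
        (RDiv (RGet ''P'' (nvar ''L'') (nvar ''i'')) (relt ''d'' (nvar ''L'')))))))"

lemma run_append_column:
  assumes nats: "nats s ''k'' 0 0 = k" "nats s ''q'' 0 0 = p"
    and r: "\<And>i. i < p \<Longrightarrow> reals s ''r'' i 0 = r i" and rho: "reals s ''rho'' 0 0 = rho"
  shows "run append_column s p (\<lambda>s'. frame {''L'', ''k_out'', ''i'', ''a''} {''g''} s s' \<and>
     nats s' ''L'' 0 0 = k \<and> nats s' ''k_out'' 0 0 = Suc k \<and> (\<forall>i<p. reals s' ''g'' i 0 = r i / rho))"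
proof -
  define s1 where "s1 = set_nat ''k_out'' 0 0 (Suc k) (set_nat ''L'' 0 0 k s)"
  have f1: "frame {''L'', ''k_out''} {} s s1" by (simp add: s1_def frame_def)
  have s1: "nats s1 ''q'' 0 0 = p" "nats s1 ''L'' 0 0 = k" "nats s1 ''k_out'' 0 0 = Suc k"
    by (simp_all add: s1_def nats)
  have "run (For ''i'' (nvar ''q'') (RSet ''g'' (nvar ''i'') (NConst 0) (RDiv (relt ''r'' (nvar ''i'')) (relt ''rho'' (NConst 0)))))
      s1 p (writes {''i''} ''g'' (\<lambda>i l. i < p \<and> l = 0) (\<lambda>i l. r i / rho) s1)"
  proof (rule run_fill_vec)
    show "reval (RDiv (relt ''r'' (nvar ''i'')) (relt ''rho'' (NConst 0))) s' = r i / rho"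
      if "i < p" "frame {''i''} {''g''} s1 s'" "nats s' ''i'' 0 0 = i" for i s'
      using that(1,3) r rho by (simp add: frame_reals[OF that(2)] frame_reals[OF f1])
  qed (simp_all add: s1)
  then have "run (For ''i'' (nvar ''q'') (RSet ''g'' (nvar ''i'') (NConst 0) (RDiv (relt ''r'' (nvar ''i'')) (relt ''rho'' (NConst 0)))))
      s1 p (\<lambda>s'. frame {''L'', ''k_out'', ''i'', ''a''} {''g''} s s' \<and>
     nats s' ''L'' 0 0 = k \<and> nats s' ''k_out'' 0 0 = Suc k \<and> (\<forall>i<p. reals s' ''g'' i 0 = r i / rho))"
  proof (rule run_weaken)
    fix s' assume w: "writes {''i''} ''g'' (\<lambda>i l. i < p \<and> l = 0) (\<lambda>i l. r i / rho) s1 s'"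
    have "frame {''L'', ''k_out'', ''i'', ''a''} {''g''} s s'" by (rule frame_trans[OF f1 writes_frame[OF w]]) auto
    then show "frame {''L'', ''k_out'', ''i'', ''a''} {''g''} s s' \<and>
     nats s' ''L'' 0 0 = k \<and> nats s' ''k_out'' 0 0 = Suc k \<and> (\<forall>i<p. reals s' ''g'' i 0 = r i / rho)"
      by (simp add: frame_nats[OF writes_frame[OF w]] writes_index[OF w] s1)
  qed simp
  then show ?thesis
    unfolding append_column_def
    by (intro run_Seq[where ?c1.0 = 0 and ?c2.0 = p] run_NSet) (simp_all add: nats s1_def)
qed

lemma run_exchange_column:
  assumes nats: "nats s ''k'' 0 0 = k" "nats s ''q'' 0 0 = p"
    and d: "\<And>a. a < k \<Longrightarrow> reals s ''d'' a 0 = d a" and y: "\<And>a. a < k \<Longrightarrow> reals s ''y'' a 0 = y a"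
    and P: "\<And>a i. a < k \<Longrightarrow> i < p \<Longrightarrow> reals s ''P'' a i = P a i"
    and ex: "\<exists>a<k. 0 < d a"
  shows "run exchange_column s (k * 4 + p) (\<lambda>s'. frame {''L'', ''k_out'', ''i'', ''a''} {''g''} s s' \<and>
     (\<exists>l. nats s' ''L'' 0 0 = l \<and> nats s' ''k_out'' 0 0 = k \<and> l < k \<and> 0 < d l \<and>
        (\<forall>b<k. 0 < d b \<longrightarrow> y l / d l \<le> y b / d b) \<and> (\<forall>i<p. reals s' ''g'' i 0 = P l i / d l)))"
    (is "run _ _ _ ?Q")
proof -
  define s1 where "s1 = set_nat ''k_out'' 0 0 k (set_nat ''L'' 0 0 k s)"
  have f1: "frame {''L'', ''k_out''} {} s s1" by (simp add: s1_def frame_def)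
  have s1: "nats s1 ''k'' 0 0 = k" "nats s1 ''L'' 0 0 = k" "nats s1 ''k_out'' 0 0 = k"
    by (simp_all add: s1_def nats)
  have "run ratio_test s1 (k * 4) (\<lambda>s'. frame {''a'', ''L''} {} s1 s' \<and> ratio_min k d y k (nats s' ''L'' 0 0))"
    by (rule run_ratio_test) (simp_all add: s1 frame_reals[OF f1] d y)
  then have "run (Seq ratio_test
     (For ''i'' (nvar ''q'') (RSet ''g'' (nvar ''i'') (NConst 0)
        (RDiv (RGet ''P'' (nvar ''L'') (nvar ''i'')) (relt ''d'' (nvar ''L'')))))) s1 (k * 4 + p) ?Q"
  proof (rule run_Seq[where ?c1.0 = "k * 4" and ?c2.0 = p, OF run_weaken])
    fix s2 assume s2: "frame {''a'', ''L''} {} s1 s2 \<and> ratio_min k d y k (nats s2 ''L'' 0 0)"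
    define l where "l = nats s2 ''L'' 0 0"
    \<comment> \<open>Some entry of \<open>d\<close> is positive, so the invariant rules out the
      sentinel.\<close>
    have l: "l < k" "0 < d l" "\<forall>b<k. 0 < d b \<longrightarrow> y l / d l \<le> y b / d b"
      using s2 ex unfolding ratio_min_def l_def[symmetric] by auto
    have f12: "frame {''a'', ''L''} {} s1 s2" using s2 by blast
    have f2: "frame {''L'', ''k_out'', ''a''} {} s s2" by (rule frame_trans[OF f1 f12]) auto
    let ?e = "RDiv (RGet ''P'' (nvar ''L'') (nvar ''i'')) (relt ''d'' (nvar ''L''))"
    have "run (For ''i'' (nvar ''q'') (RSet ''g'' (nvar ''i'') (NConst 0) ?e)) s2 p
        (writes {''i''} ''g'' (\<lambda>i l. i < p \<and> l = 0) (\<lambda>i l'. P l i / d l) s2)"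
    proof (rule run_fill_vec)
      show "reval ?e s' = P l i / d l" if "i < p" "frame {''i''} {''g''} s2 s'" "nats s' ''i'' 0 0 = i" for i s'
        using that(1,3) l d P
        by (simp add: frame_reals[OF that(2)] frame_reals[OF f2] frame_nats[OF that(2)] flip: l_def)
    qed (simp_all add: frame_nats[OF f2] nats)
    then show "run (For ''i'' (nvar ''q'') (RSet ''g'' (nvar ''i'') (NConst 0) ?e)) s2 p ?Q"
    proof (rule run_weaken)
      fix s' assume w: "writes {''i''} ''g'' (\<lambda>i l. i < p \<and> l = 0) (\<lambda>i l'. P l i / d l) s2 s'"
      have "frame {''L'', ''k_out'', ''i'', ''a''} {''g''} s s'" by (rule frame_trans[OF f2 writes_frame[OF w]]) auto
      moreover have "nats s' ''L'' 0 0 = l" "nats s' ''k_out'' 0 0 = k"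
        by (simp_all add: frame_nats[OF writes_frame[OF w]] frame_nats[OF f12] s1 flip: l_def)
      ultimately show "?Q s'" using l by (simp add: writes_index[OF w])
    qed simp
  qed simp_all
  then show ?thesis
    unfolding exchange_column_def
    by - (rule run_Seq[where ?c1.0 = 0 and ?c2.0 = "k * 4 + p"], rule run_NSet,
        rule run_Seq[where ?c1.0 = 0 and ?c2.0 = "k * 4 + p"], rule run_NSet, simp_all add: nats s1_def)
qed

definition select :: prog where
  "select = IfThenElse (REq (relt ''rho'' (NConst 0)) RZero) exchange_column append_column"

text \<open>The bound is the cost of the exchange branch, the more expensive one, plus one
  comparison for the test of \<open>rho\<close>.\<close>

lemma run_select:
  assumes nats: "nats s ''k'' 0 0 = k" "nats s ''q'' 0 0 = p"
    and d: "\<And>a. a < k \<Longrightarrow> reals s ''d'' a 0 = d a" and y: "\<And>a. a < k \<Longrightarrow> reals s ''y'' a 0 = y a"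
    and P: "\<And>a i. a < k \<Longrightarrow> i < p \<Longrightarrow> reals s ''P'' a i = P a i"
    and r: "\<And>i. i < p \<Longrightarrow> reals s ''r'' i 0 = r i" and rho: "reals s ''rho'' 0 0 = rho"
    and ex: "rho = 0 \<Longrightarrow> \<exists>a<k. 0 < d a"
  shows "run select s (k * 4 + p + 1) (\<lambda>s'. frame {''L'', ''k_out'', ''i'', ''a''} {''g''} s s' \<and>
     (\<exists>l k' g. nats s' ''L'' 0 0 = l \<and> nats s' ''k_out'' 0 0 = k' \<and> (\<forall>i<p. reals s' ''g'' i 0 = g i) \<and>
       (rho \<noteq> 0 \<and> l = k \<and> k' = Suc k \<and> (\<forall>i<p. g i = r i / rho) \<or>
        rho = 0 \<and> l < k \<and> k' = k \<and> 0 < d l \<and> (\<forall>b<k. 0 < d b \<longrightarrow> y l / d l \<le> y b / d b) \<and>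
         (\<forall>i<p. g i = P l i / d l))))"
  unfolding select_def
proof (rule run_If[where c' = "k * 4 + p"])
  assume "beval (REq (relt ''rho'' (NConst 0)) RZero) s"
  then have 0: "rho = 0" using rho by simp
  show "run exchange_column s (k * 4 + p) (\<lambda>s'. frame {''L'', ''k_out'', ''i'', ''a''} {''g''} s s' \<and>
     (\<exists>l k' g. nats s' ''L'' 0 0 = l \<and> nats s' ''k_out'' 0 0 = k' \<and> (\<forall>i<p. reals s' ''g'' i 0 = g i) \<and>
       (rho \<noteq> 0 \<and> l = k \<and> k' = Suc k \<and> (\<forall>i<p. g i = r i / rho) \<or>
        rho = 0 \<and> l < k \<and> k' = k \<and> 0 < d l \<and> (\<forall>b<k. 0 < d b \<longrightarrow> y l / d l \<le> y b / d b) \<and>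
         (\<forall>i<p. g i = P l i / d l))))"
    by (rule run_weaken[OF run_exchange_column[OF nats d y P ex[OF 0]]]) (use 0 in auto)
next
  assume "\<not> beval (REq (relt ''rho'' (NConst 0)) RZero) s"
  then have 0: "rho \<noteq> 0" using rho by simp
  show "run append_column s (k * 4 + p) (\<lambda>s'. frame {''L'', ''k_out'', ''i'', ''a''} {''g''} s s' \<and>
     (\<exists>l k' g. nats s' ''L'' 0 0 = l \<and> nats s' ''k_out'' 0 0 = k' \<and> (\<forall>i<p. reals s' ''g'' i 0 = g i) \<and>
       (rho \<noteq> 0 \<and> l = k \<and> k' = Suc k \<and> (\<forall>i<p. g i = r i / rho) \<or>
        rho = 0 \<and> l < k \<and> k' = k \<and> 0 < d l \<and> (\<forall>b<k. 0 < d b \<longrightarrow> y l / d l \<le> y b / d b) \<and>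
         (\<forall>i<p. g i = P l i / d l))))"
    by (rule run_weaken[OF run_append_column[OF nats r rho]]) (use 0 in auto)
qed simp

section \<open>Writing the new basis, pseudoinverse and point\<close>

text \<open>Storing \<open>j\<close> last at position \<open>L\<close> appends it when
  \<open>L = k\<close> and overwrites the leaving index when \<open>L < k\<close>.\<close>

definition copy_indices :: prog where
  "copy_indices = Seq (For ''a'' (nvar ''k'') (NSet ''B_out'' (nvar ''a'') (NConst 0) (nelt ''B'' (nvar ''a''))))
     (NSet ''B_out'' (nvar ''L'') (NConst 0) (nvar ''j''))"

lemma run_copy_indices:
  assumes nats: "nats s ''k'' 0 0 = k" "nats s ''L'' 0 0 = l" "nats s ''j'' 0 0 = j"
    and B: "\<And>a. a < k \<Longrightarrow> nats s ''B'' a 0 = B ! a"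
  shows "run copy_indices s 0 (\<lambda>s'. frame {''a'', ''B_out''} {} s s' \<and>
     (\<forall>a. a < k \<or> a = l \<longrightarrow> nats s' ''B_out'' a 0 = (if a = l then j else B ! a)))"
  unfolding copy_indices_def
proof (rule run_Seq[where ?c1.0 = 0 and ?c2.0 = 0], rule run_For[where N = k and c = 0 and
      I = "\<lambda>n s'. frame {''a'', ''B_out''} {} s s' \<and> (\<forall>b<n. nats s' ''B_out'' b 0 = B ! b)"])
  fix i s' assume i: "i < k" and I: "frame {''a'', ''B_out''} {} s s' \<and> (\<forall>b<i. nats s' ''B_out'' b 0 = B ! b)"
  have fr: "frame {''a'', ''B_out''} {} s s'" using I by blast
  have b: "nats s' ''B'' i 0 = B ! i" using i B by (simp add: frame_nats[OF fr])
  show "run (NSet ''B_out'' (nvar ''a'') (NConst 0) (nelt ''B'' (nvar ''a''))) (set_nat ''a'' 0 0 i s') 0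
     (\<lambda>s'. frame {''a'', ''B_out''} {} s s' \<and> (\<forall>b<Suc i. nats s' ''B_out'' b 0 = B ! b))"
    using I by (intro run_NSet) (simp add: b frame_def less_Suc_eq)
next
  fix s' assume I: "frame {''a'', ''B_out''} {} s s' \<and> (\<forall>b<k. nats s' ''B_out'' b 0 = B ! b)"
  then have fr: "frame {''a'', ''B_out''} {} s s'" by blast
  have *: "nats s' ''L'' 0 0 = l" "nats s' ''j'' 0 0 = j" by (simp_all add: frame_nats[OF fr] nats)
  show "run (NSet ''B_out'' (nvar ''L'') (NConst 0) (nvar ''j'')) s' 0 (\<lambda>s'. frame {''a'', ''B_out''} {} s s' \<and>
     (\<forall>a. a < k \<or> a = l \<longrightarrow> nats s' ''B_out'' a 0 = (if a = l then j else B ! a)))"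
    using I by (intro run_NSet) (simp add: * frame_def)
qed (simp_all add: nats frame_def)

text \<open>The pivot row is written last, so in an exchange it replaces what the general rule has
  put there.\<close>

definition update_pinv :: prog where
  "update_pinv = Seq (For ''a'' (nvar ''k'') (For ''i'' (nvar ''q'') (RSet ''P_out'' (nvar ''a'') (nvar ''i'')
       (RSub (RGet ''P'' (nvar ''a'') (nvar ''i'')) (RMul (relt ''d'' (nvar ''a'')) (relt ''g'' (nvar ''i'')))))))
     (For ''i'' (nvar ''q'') (RSet ''P_out'' (nvar ''L'') (nvar ''i'') (relt ''g'' (nvar ''i''))))"

lemma run_update_pinv:
  assumes nats: "nats s ''k'' 0 0 = k" "nats s ''q'' 0 0 = p" "nats s ''L'' 0 0 = l"
    and d: "\<And>a. a < k \<Longrightarrow> reals s ''d'' a 0 = d a" and g: "\<And>i. i < p \<Longrightarrow> reals s ''g'' i 0 = g i"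
    and P: "\<And>a i. a < k \<Longrightarrow> i < p \<Longrightarrow> reals s ''P'' a i = P a i"
  shows "run update_pinv s (2 * (k * p)) (\<lambda>s'. frame {''a'', ''i''} {''P_out''} s s' \<and>
     (\<forall>a i. (a < k \<or> a = l) \<and> i < p \<longrightarrow> reals s' ''P_out'' a i = (if a = l then g i else P a i - d a * g i)))"
  unfolding update_pinv_def
proof (rule run_Seq[where ?c1.0 = "2 * (k * p)" and ?c2.0 = 0, OF run_weaken])
  let ?e = "RSub (RGet ''P'' (nvar ''a'') (nvar ''i'')) (RMul (relt ''d'' (nvar ''a'')) (relt ''g'' (nvar ''i'')))"
  show "run (For ''a'' (nvar ''k'') (For ''i'' (nvar ''q'') (RSet ''P_out'' (nvar ''a'') (nvar ''i'') ?e))) s (2 * (k * p))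
      (writes {''a'', ''i''} ''P_out'' (\<lambda>a i. a < k \<and> i < p) (\<lambda>a i. P a i - d a * g i) s)"
  proof (rule run_fill_mat[where c = 2])
    fix a i s' assume ai: "a < k" "i < p" and fr: "frame {''a'', ''i''} {''P_out''} s s'"
      and s': "nats s' ''a'' 0 0 = a" "nats s' ''i'' 0 0 = i"
    show "run (RSet ''P_out'' (nvar ''a'') (nvar ''i'') ?e) s' 2
       (writes {} ''P_out'' (\<lambda>i' l'. i' = a \<and> l' = i) (\<lambda>a i. P a i - d a * g i) s')"
      using ai by (intro run_RSet_writes) (simp_all add: s' frame_reals[OF fr] P d g)
  qed (simp_all add: nats frame_nats)
next
  fix s1 assume w: "writes {''a'', ''i''} ''P_out'' (\<lambda>a i. a < k \<and> i < p) (\<lambda>a i. P a i - d a * g i) s s1"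
  note f1 = writes_frame[OF w]
  have "run (For ''i'' (nvar ''q'') (RSet ''P_out'' (nvar ''L'') (nvar ''i'') (relt ''g'' (nvar ''i'')))) s1 0
     (writes {''a'', ''i''} ''P_out'' (\<lambda>a i. a = l \<and> i < p) (\<lambda>a i. g i) s1)"
  proof (rule run_fill[where N = p and c = 0 and D = "\<lambda>b a i. a = l \<and> i = b"])
    fix i s' assume i: "i < p" and fr: "frame {''a'', ''i''} {''P_out''} s1 s'" and s': "nats s' ''i'' 0 0 = i"
    show "run (RSet ''P_out'' (nvar ''L'') (nvar ''i'') (relt ''g'' (nvar ''i''))) s' 0
      (writes {''a'', ''i''} ''P_out'' (\<lambda>a i'. a = l \<and> i' = i) (\<lambda>a i. g i) s')"
      using i by (intro run_RSet_writes)
        (simp_all add: s' frame_nats[OF fr] frame_nats[OF f1] frame_reals[OF fr] frame_reals[OF f1] nats g)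
  qed (auto simp: frame_nats[OF f1] nats)
  then show "run (For ''i'' (nvar ''q'') (RSet ''P_out'' (nvar ''L'') (nvar ''i'') (relt ''g'' (nvar ''i'')))) s1 0
     (\<lambda>s'. frame {''a'', ''i''} {''P_out''} s s' \<and>
     (\<forall>a i. (a < k \<or> a = l) \<and> i < p \<longrightarrow> reals s' ''P_out'' a i = (if a = l then g i else P a i - d a * g i)))"
  proof (rule run_weaken)
    fix s' assume w': "writes {''a'', ''i''} ''P_out'' (\<lambda>a i. a = l \<and> i < p) (\<lambda>a i. g i) s1 s'"
    have "frame {''a'', ''i''} {''P_out''} s s'" by (rule frame_trans[OF f1 writes_frame[OF w']]) auto
    then show "frame {''a'', ''i''} {''P_out''} s s' \<and>
     (\<forall>a i. (a < k \<or> a = l) \<and> i < p \<longrightarrow> reals s' ''P_out'' a i = (if a = l then g i else P a i - d a * g i))"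
      by (simp add: writes_index[OF w'] writes_index[OF w])
  qed simp
qed simp_all

text \<open>In an exchange the leaving index also receives \<open>y a - d a * tau\<close>; this
  value is 0 there by the choice of \<open>tau\<close>, so one rule serves both cases.\<close>

definition write_point :: prog where
  "write_point = Seq (For ''l'' (nvar ''n'') (RSet ''x_out'' (nvar ''l'') (NConst 0) RZero))
     (Seq (For ''a'' (nvar ''k'') (RSet ''x_out'' (nelt ''B'' (nvar ''a'')) (NConst 0)
        (RSub (relt ''y'' (nvar ''a'')) (RMul (relt ''d'' (nvar ''a'')) (relt ''tau'' (NConst 0))))))
     (RSet ''x_out'' (nvar ''j'') (NConst 0) (relt ''tau'' (NConst 0))))"

lemma run_write_point:
  assumes nats: "nats s ''k'' 0 0 = k" "nats s ''n'' 0 0 = n" "nats s ''j'' 0 0 = j"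
    and d: "\<And>a. a < k \<Longrightarrow> reals s ''d'' a 0 = d a" and y: "\<And>a. a < k \<Longrightarrow> reals s ''y'' a 0 = y a"
    and tau: "reals s ''tau'' 0 0 = tau"
    and B: "\<And>a. a < k \<Longrightarrow> nats s ''B'' a 0 = B ! a" "k = length B" "distinct B" "j \<notin> set B"
  shows "run write_point s (2 * k) (\<lambda>s'. frame {''l'', ''a''} {''x_out''} s s' \<and>
     reals s' ''x_out'' j 0 = tau \<and> (\<forall>a<k. reals s' ''x_out'' (B ! a) 0 = y a - d a * tau) \<and>
     (\<forall>c<n. c \<notin> insert j (set B) \<longrightarrow> reals s' ''x_out'' c 0 = 0))"
proof -
  \<comment> \<open>\<open>writes\<close> wants values by cell, while the coordinates are given by
    position in \<open>B\<close>; distinctness of \<open>B\<close> makes the translation well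
    defined.\<close>
  define F where "F c = (let a = inv_into {..<k} ((!) B) c in y a - d a * tau)" for c
  have "inj_on ((!) B) {..<k}" using B(2,3) by (auto simp: inj_on_def nth_eq_iff_index_eq)
  then have F: "F (B ! a) = y a - d a * tau" if "a < k" for a using that by (simp add: F_def)
  let ?p1 = "For ''l'' (nvar ''n'') (RSet ''x_out'' (nvar ''l'') (NConst 0) RZero)"
  let ?e = "RSub (relt ''y'' (nvar ''a'')) (RMul (relt ''d'' (nvar ''a'')) (relt ''tau'' (NConst 0)))"
  let ?p2 = "For ''a'' (nvar ''k'') (RSet ''x_out'' (nelt ''B'' (nvar ''a'')) (NConst 0) ?e)"
  let ?p3 = "RSet ''x_out'' (nvar ''j'') (NConst 0) (relt ''tau'' (NConst 0))"
  have "run ?p1 s 0 (writes {''l''} ''x_out'' (\<lambda>c i. c < n \<and> i = 0) (\<lambda>c i. 0) s)"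
    by (rule run_fill_vec) (simp_all add: nats)
  then obtain s1 t1 where 1: "exec ?p1 s = (s1, t1)" "t1 \<le> 0"
    and w1: "writes {''l''} ''x_out'' (\<lambda>c i. c < n \<and> i = 0) (\<lambda>c i. 0) s s1" by (rule run_obtain)
  note f1 = writes_frame[OF w1]
  have "run ?p2 s1 (2 * k) (writes {''a''} ''x_out'' (\<lambda>c i. (\<exists>b<k. c = B ! b \<and> i = 0)) (\<lambda>c i. F c) s1)"
  proof (rule run_fill[where N = k and c = 2 and D = "\<lambda>b c i. c = B ! b \<and> i = 0"])
    fix a s' assume a: "a < k" and fr: "frame {''a''} {''x_out''} s1 s'" and s': "nats s' ''a'' 0 0 = a"
    show "run (RSet ''x_out'' (nelt ''B'' (nvar ''a'')) (NConst 0) ?e) s' 2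
      (writes {''a''} ''x_out'' (\<lambda>c i. c = B ! a \<and> i = 0) (\<lambda>c i. F c) s')"
      using a by (intro run_RSet_writes)
        (simp_all add: s' frame_nats[OF fr] frame_nats[OF f1] frame_reals[OF fr] frame_reals[OF f1] B(1) y d tau F)
  qed (simp_all add: frame_nats[OF f1] nats)
  then obtain s2 t2 where 2: "exec ?p2 s1 = (s2, t2)" "t2 \<le> 2 * k"
    and w2: "writes {''a''} ''x_out'' (\<lambda>c i. (\<exists>b<k. c = B ! b \<and> i = 0)) (\<lambda>c i. F c) s1 s2" by (rule run_obtain)
  have f2: "frame {''l'', ''a''} {''x_out''} s s2" by (rule frame_trans[OF f1 writes_frame[OF w2]]) auto
  have "run ?p3 s2 0 (writes {} ''x_out'' (\<lambda>c i. c = j \<and> i = 0) (\<lambda>c i. tau) s2)"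
    by (intro run_RSet_writes) (simp_all add: frame_nats[OF f2] nats frame_reals[OF f2] tau)
  then obtain s3 t3 where 3: "exec ?p3 s2 = (s3, t3)" "t3 \<le> 0"
    and w3: "writes {} ''x_out'' (\<lambda>c i. c = j \<and> i = 0) (\<lambda>c i. tau) s2 s3" by (rule run_obtain)
  have "exec write_point s = (s3, t1 + (t2 + t3))"
    unfolding write_point_def by (rule exec_SeqI[OF 1(1) exec_SeqI[OF 2(1) 3(1)]])
  moreover have "t1 + (t2 + t3) \<le> 2 * k" using 1 2 3 by simp
  moreover have "frame {''l'', ''a''} {''x_out''} s s3" by (rule frame_trans[OF f2 writes_frame[OF w3]]) auto
  moreover have "reals s3 ''x_out'' j 0 = tau" by (simp add: writes_index[OF w3])
  moreover have "\<forall>a<k. reals s3 ''x_out'' (B ! a) 0 = y a - d a * tau"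
  proof (intro allI impI)
    fix a assume a: "a < k"
    then have "B ! a \<noteq> j" using B by auto
    then show "reals s3 ''x_out'' (B ! a) 0 = y a - d a * tau"
      using a by (auto simp: writes_index[OF w3] writes_index[OF w2] F)
  qed
  moreover have "\<forall>c<n. c \<notin> insert j (set B) \<longrightarrow> reals s3 ''x_out'' c 0 = 0"
    using B(2) by (auto simp: writes_index[OF w3] writes_index[OF w2] writes_index[OF w1])
  ultimately show ?thesis unfolding run_def by blast
qed

section \<open>The complete step and its correctness\<close>

definition basis_step :: prog where
  "basis_step = Seq solve (Seq select
     (Seq (accumulate ''tau'' (NConst 0) RZero ''i'' (nvar ''q'') (RMul (relt ''g'' (nvar ''i'')) (relt ''w'' (nvar ''i''))))
     (Seq update_pinv (Seq copy_indices write_point))))"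

text \<open>The bound collects 7 and 2 operations per matrix entry for \<open>solve\<close> and
  \<open>update_pinv\<close>; per row 2 for \<open>rho\<close>, 1 for \<open>g\<close> and 2 for
  \<open>tau\<close>; per basis position 4 for the ratio test and 2 for the new point; and 1 for the
  test of \<open>rho\<close>.\<close>

lemma run_basis_step:
  assumes nats: "nats s ''m'' 0 0 = m" "nats s ''n'' 0 0 = n" "nats s ''k'' 0 0 = k" "nats s ''j'' 0 0 = j"
    and B: "\<And>a. a < k \<Longrightarrow> nats s ''B'' a 0 = B ! a" "\<And>a. a < k \<Longrightarrow> B ! a < n"
      "k = length B" "distinct B" "j \<notin> set B"
    and j: "j < n"
    and A: "\<And>i l. i < m \<Longrightarrow> l < n \<Longrightarrow> reals s ''A'' i l = A $$ (i, l)"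
    and z: "\<And>i. i < m \<Longrightarrow> reals s ''z'' i 0 = z $ i"
    and P: "\<And>a i. a < k \<Longrightarrow> i < Suc m \<Longrightarrow> reals s ''P'' a i = P a i"
  assumes T: "T = (\<lambda>i l. if i = 0 then 1 else A $$ (i - 1, l))"
    and w: "w = (\<lambda>i. if i = 0 then 1 else z $ (i - 1))"
    and d: "d = (\<lambda>a. \<Sum>i<Suc m. P a i * T i j)"
    and y: "y = (\<lambda>a. \<Sum>i<Suc m. P a i * w i)"
    and r: "r = (\<lambda>i. T i j - (\<Sum>a<k. T i (B ! a) * d a))"
    and rho: "rho = (\<Sum>i<Suc m. r i * r i)"
    and ex: "rho = 0 \<Longrightarrow> \<exists>a<k. 0 < d a"
  obtains s' t l k' g tau where
    "exec basis_step s = (s', t)" "t \<le> 9 * (k * Suc m) + 5 * Suc m + 6 * k + 1"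
    "rho \<noteq> 0 \<and> l = k \<and> k' = Suc k \<and> (\<forall>i<Suc m. g i = r i / rho) \<or>
        rho = 0 \<and> l < k \<and> k' = k \<and> 0 < d l \<and> (\<forall>b<k. 0 < d b \<longrightarrow> y l / d l \<le> y b / d b) \<and>
         (\<forall>i<Suc m. g i = P l i / d l)"
    "tau = (\<Sum>i<Suc m. g i * w i)"
    "nats s' ''k_out'' 0 0 = k'"
    "\<And>a. a < k' \<Longrightarrow> nats s' ''B_out'' a 0 = (if a = l then j else B ! a)"
    "\<And>a i. a < k' \<Longrightarrow> i < Suc m \<Longrightarrow> reals s' ''P_out'' a i = (if a = l then g i else P a i - d a * g i)"
    "reals s' ''x_out'' j 0 = tau"
    "\<And>a. a < k \<Longrightarrow> reals s' ''x_out'' (B ! a) 0 = y a - d a * tau"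
    "\<And>c. c < n \<Longrightarrow> c \<notin> insert j (set B) \<Longrightarrow> reals s' ''x_out'' c 0 = 0"
proof -
  obtain s1 t1 where e1: "exec solve s = (s1, t1)" "t1 \<le> 7 * (k * Suc m) + 2 * Suc m"
    and f1: "frame {''q'', ''i'', ''l'', ''a''} {''T'', ''w'', ''d'', ''y'', ''r'', ''rho''} s s1"
    and q1: "nats s1 ''q'' 0 0 = Suc m" and w1: "\<And>i. i < Suc m \<Longrightarrow> reals s1 ''w'' i 0 = w i"
    and d1: "\<And>a. a < k \<Longrightarrow> reals s1 ''d'' a 0 = d a" and y1: "\<And>a. a < k \<Longrightarrow> reals s1 ''y'' a 0 = y a"
    and r1: "\<And>i. i < Suc m \<Longrightarrow> reals s1 ''r'' i 0 = r i" and rho1: "reals s1 ''rho'' 0 0 = rho"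
    using run_solve[OF nats B(1,2) j A z P] unfolding run_def T w d y r rho by blast
  have in1: "nats s1 ''k'' 0 0 = k" "\<And>a i. a < k \<Longrightarrow> i < Suc m \<Longrightarrow> reals s1 ''P'' a i = P a i"
    using nats P by (simp_all add: frame_nats[OF f1] frame_reals[OF f1])
  obtain s2 t2 l k' g where e2: "exec select s1 = (s2, t2)" "t2 \<le> k * 4 + Suc m + 1"
    and f12: "frame {''L'', ''k_out'', ''i'', ''a''} {''g''} s1 s2"
    and L2: "nats s2 ''L'' 0 0 = l" and k2: "nats s2 ''k_out'' 0 0 = k'"
    and g2: "\<And>i. i < Suc m \<Longrightarrow> reals s2 ''g'' i 0 = g i"
    and cases: "rho \<noteq> 0 \<and> l = k \<and> k' = Suc k \<and> (\<forall>i<Suc m. g i = r i / rho) \<or>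
        rho = 0 \<and> l < k \<and> k' = k \<and> 0 < d l \<and> (\<forall>b<k. 0 < d b \<longrightarrow> y l / d l \<le> y b / d b) \<and>
         (\<forall>i<Suc m. g i = P l i / d l)"
    using run_select[OF in1(1) q1 d1 y1 in1(2) r1 rho1 ex] unfolding run_def by blast
  have in2: "nats s2 ''q'' 0 0 = Suc m" "\<And>i. i < Suc m \<Longrightarrow> reals s2 ''w'' i 0 = w i"
    using q1 w1 by (simp_all add: frame_nats[OF f12] frame_reals[OF f12])
  define tau where "tau = (\<Sum>i<Suc m. g i * w i)"
  let ?e = "RMul (relt ''g'' (nvar ''i'')) (relt ''w'' (nvar ''i''))"
  let ?p = "accumulate ''tau'' (NConst 0) RZero ''i'' (nvar ''q'') ?e"
  have "run ?p s2 (Suc m * (rcost ?e + 1)) (writes {''i''} ''tau'' (\<lambda>i l. i = 0 \<and> l = 0) (\<lambda>i l. \<Sum>i<Suc m. g i * w i) s2)"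
  proof (rule run_accumulate_scalar)
    show "reval ?e s' = g i * w i" if "i < Suc m" "frame {''i''} {''tau''} s2 s'" "nats s' ''i'' 0 0 = i" for i s'
      using that(1,3) by (simp add: frame_reals[OF that(2)] g2 in2)
  qed (simp add: in2)
  then obtain s3 t3 where e3: "exec ?p s2 = (s3, t3)" "t3 \<le> Suc m * (rcost ?e + 1)"
    and w3: "writes {''i''} ''tau'' (\<lambda>i l. i = 0 \<and> l = 0) (\<lambda>i l. \<Sum>i<Suc m. g i * w i) s2 s3"
    by (rule run_obtain)
  have f13: "frame {''L'', ''k_out'', ''i'', ''a''} {''g'', ''tau''} s1 s3"
    by (rule frame_trans[OF f12 writes_frame[OF w3]]) auto
  have f3: "frame {''q'', ''i'', ''l'', ''a'', ''L'', ''k_out''} {''T'', ''w'', ''d'', ''y'', ''r'', ''rho'', ''g'', ''tau''} s s3"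
    by (rule frame_trans[OF f1 f13]) auto
  have in3: "nats s3 ''k'' 0 0 = k" "nats s3 ''q'' 0 0 = Suc m" "nats s3 ''L'' 0 0 = l" "nats s3 ''j'' 0 0 = j"
    "nats s3 ''n'' 0 0 = n" "nats s3 ''k_out'' 0 0 = k'"
    using nats q1 L2 k2
    by (simp_all add: frame_nats[OF f3] frame_nats[OF f13] frame_nats[OF writes_frame[OF w3]])
  have re3: "\<And>a. a < k \<Longrightarrow> reals s3 ''d'' a 0 = d a" "\<And>a. a < k \<Longrightarrow> reals s3 ''y'' a 0 = y a"
    "\<And>a i. a < k \<Longrightarrow> i < Suc m \<Longrightarrow> reals s3 ''P'' a i = P a i"
    using d1 y1 in1 by (simp_all add: frame_reals[OF f13])
  have B3: "\<And>a. a < k \<Longrightarrow> nats s3 ''B'' a 0 = B ! a" using B by (simp add: frame_nats[OF f3])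
  have g3: "\<And>i. i < Suc m \<Longrightarrow> reals s3 ''g'' i 0 = g i" by (simp add: frame_reals[OF writes_frame[OF w3]] g2)
  have tau3: "reals s3 ''tau'' 0 0 = tau" by (simp add: writes_index[OF w3] tau_def)
  obtain s4 t4 where e4: "exec update_pinv s3 = (s4, t4)" "t4 \<le> 2 * (k * Suc m)"
    and f34: "frame {''a'', ''i''} {''P_out''} s3 s4"
    and P4: "\<And>a i. a < k \<or> a = l \<Longrightarrow> i < Suc m \<Longrightarrow> reals s4 ''P_out'' a i = (if a = l then g i else P a i - d a * g i)"
    using run_update_pinv[OF in3(1,2,3) re3(1) g3 re3(3)] unfolding run_def by blast
  have in4: "nats s4 ''k'' 0 0 = k" "nats s4 ''L'' 0 0 = l" "nats s4 ''j'' 0 0 = j"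
    by (simp_all add: frame_nats[OF f34] in3)
  have B4: "\<And>a. a < k \<Longrightarrow> nats s4 ''B'' a 0 = B ! a" using B3 by (simp add: frame_nats[OF f34])
  obtain s5 t5 where e5: "exec copy_indices s4 = (s5, t5)" "t5 \<le> 0"
    and f45: "frame {''a'', ''B_out''} {} s4 s5"
    and B5: "\<And>a. a < k \<or> a = l \<Longrightarrow> nats s5 ''B_out'' a 0 = (if a = l then j else B ! a)"
    using run_copy_indices[OF in4 B4] unfolding run_def by blast
  have f35: "frame {''a'', ''i'', ''B_out''} {''P_out''} s3 s5" by (rule frame_trans[OF f34 f45]) auto
  have in5: "nats s5 ''k'' 0 0 = k" "nats s5 ''n'' 0 0 = n" "nats s5 ''j'' 0 0 = j"
    and re5: "\<And>a. a < k \<Longrightarrow> reals s5 ''d'' a 0 = d a" "\<And>a. a < k \<Longrightarrow> reals s5 ''y'' a 0 = y a"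
      "reals s5 ''tau'' 0 0 = tau"
    and B5': "\<And>a. a < k \<Longrightarrow> nats s5 ''B'' a 0 = B ! a"
    by (simp_all add: frame_nats[OF f35] frame_reals[OF f35] in3 re3 tau3 B3)
  obtain s6 t6 where e6: "exec write_point s5 = (s6, t6)" "t6 \<le> 2 * k"
    and f56: "frame {''l'', ''a''} {''x_out''} s5 s6" and xj: "reals s6 ''x_out'' j 0 = tau"
    and xB: "\<And>a. a < k \<Longrightarrow> reals s6 ''x_out'' (B ! a) 0 = y a - d a * tau"
    and x0: "\<And>c. c < n \<Longrightarrow> c \<notin> insert j (set B) \<Longrightarrow> reals s6 ''x_out'' c 0 = 0"
    using run_write_point[OF in5 re5 B5' B(3,4,5)] unfolding run_def by blast
  have f46: "frame {''a'', ''B_out'', ''l''} {''x_out''} s4 s6" by (rule frame_trans[OF f45 f56]) auto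
  have f36: "frame {''a'', ''i'', ''B_out'', ''l''} {''P_out'', ''x_out''} s3 s6" by (rule frame_trans[OF f35 f56]) auto
  have lt: "a < k \<or> a = l" if "a < k'" for a using cases that by auto
  show ?thesis
  proof (rule that[OF _ _ cases tau_def _ _ _ xj xB x0])
    show "exec basis_step s = (s6, t1 + (t2 + (t3 + (t4 + (t5 + t6)))))"
      unfolding basis_step_def
      by (rule exec_SeqI[OF e1(1) exec_SeqI[OF e2(1) exec_SeqI[OF e3(1) exec_SeqI[OF e4(1) exec_SeqI[OF e5(1) e6(1)]]]]])
    have add: "t1 + (t2 + (t3 + (t4 + (t5 + t6)))) \<le> 9 * X + 5 * q + 6 * k + 1"
      if "t1 \<le> 7 * X + 2 * q" "t2 \<le> k * 4 + q + 1" "t3 \<le> 2 * q" "t4 \<le> 2 * X" "t5 \<le> 0" "t6 \<le> 2 * k" for X q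
      using that by linarith
    have "t3 \<le> 2 * Suc m" using e3(2) by simp
    then show "t1 + (t2 + (t3 + (t4 + (t5 + t6)))) \<le> 9 * (k * Suc m) + 5 * Suc m + 6 * k + 1"
      by (rule add[OF e1(2) e2(2) _ e4(2) e5(2) e6(2)])
    show "nats s6 ''k_out'' 0 0 = k'" by (simp add: frame_nats[OF f36] in3)
    show "nats s6 ''B_out'' a 0 = (if a = l then j else B ! a)" if "a < k'" for a
      using B5[OF lt[OF that]] by (simp add: frame_nats[OF f56])
    show "reals s6 ''P_out'' a i = (if a = l then g i else P a i - d a * g i)" if "a < k'" "i < Suc m" for a i
      using P4[OF lt[OF that(1)] that(2)] by (simp add: frame_reals[OF f46])
  qed
qed

lemma sum_insert_nth:
  fixes f :: "nat \<Rightarrow> real"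
  assumes "distinct B" "j \<notin> set B" "insert j (set B) \<subseteq> {..<n}"
    and "\<And>i. i < n \<Longrightarrow> i \<notin> insert j (set B) \<Longrightarrow> f i = 0"
  shows "(\<Sum>i<n. f i) = (\<Sum>a<length B. f (B ! a)) + f j"
proof -
  have "(\<Sum>i<n. f i) = (\<Sum>i\<in>insert j (set B). f i)"
    by (rule sum.mono_neutral_right) (use assms in auto)
  also have "\<dots> = f j + (\<Sum>i\<in>set B. f i)" using assms by simp
  also have "(\<Sum>i\<in>set B. f i) = (\<Sum>a<length B. f (B ! a))"
    using sum.reindex_bij_betw[OF bij_betw_nth[OF assms(1) refl refl], of f] by simp
  finally show ?thesis by simp
qed

lemma sub_vec_carrier: "sub_vec u C \<in> carrier_vec (length C)"
  and sub_vec_index: "a < length C \<Longrightarrow> sub_vec u C $ a = u $ (C ! a)"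
  by (auto simp: sub_vec_def index_vec_of_list simp del: vec_of_list_map intro!: carrier_vecI)

text \<open>The point \<open>x\<close> enters only the argument and is never read by the program. It
  shows that the lifted system has a nonnegative solution, which \<open>pivot_point\<close> turns
  into the computed one.\<close>

lemma basis_step_correct:
  assumes m: "m \<ge> 1" and A: "A \<in> carrier_mat m n" and B: "ordered_index_set n B"
    and ai: "affinely_independent_cols (sub_cols A B)" and j: "j < n" "j \<notin> set B"
    and x: "x \<in> simplex n" and x0: "\<forall>i<n. i \<notin> set (B @ [j]) \<longrightarrow> x $ i = 0"
    and z: "z = sub_cols A B *\<^sub>v sub_vec x B + (x $ j) \<cdot>\<^sub>v col A j"
    and inp: "input_state s A B j z (pinv (sub_cols (ones_on_top A) B))"
  shows "\<exists>s' t xp Bp. exec basis_step s = (s', t) \<and> t \<le> 84 * m\<^sup>2 \<and>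
        output_state s' xp Bp (pinv (sub_cols (ones_on_top A) Bp)) \<and>
        xp \<in> simplex n \<and> ordered_index_set n Bp \<and> set Bp \<subseteq> set (B @ [j]) \<and>
        z = sub_cols A Bp *\<^sub>v sub_vec xp Bp \<and> affinely_independent_cols (sub_cols A Bp)"
proof -
  define k where "k = length B"
  define T where "T = (\<lambda>i l. if i = 0 then 1 else A $$ (i - 1, l))"
  define w where "w = (\<lambda>i. if i = 0 then 1 else z $ (i - 1))"
  define M where "M i a = T i (B ! a)" for i a
  define P where "P a i = pinv (sub_cols (ones_on_top A) B) $$ (a, i)" for a i
  have dB: "distinct B" and sB: "set B \<subseteq> {..<n}" using B by (auto simp: ordered_index_set_def)
  have Bn: "B ! a < n" if "a < k" for a using subsetD[OF sB nth_mem[of a B]] that by (simp add: k_def)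
  note S = sub_cols_ones_on_top[OF A sB, folded k_def]
  have inj: "c = 0\<^sub>v k" if "c \<in> carrier_vec k" "sub_cols (ones_on_top A) B *\<^sub>v c = 0\<^sub>v (Suc m)" for c
    using ai that unfolding affinely_independent_iff_injective[OF A sB] k_def by blast
  have Pc: "pinv (sub_cols (ones_on_top A) B) \<in> carrier_mat k (Suc m)"
    by (rule pinv_mp_inverse(1)[OF S(1) inj])
  have X: "mp_inverse_on (Suc m) k M P"
    by (rule mp_inverse_on_cong[OF pinv_mp_inverse(2)[OF S(1) inj]])
      (auto simp: M_def P_def T_def S(2) Bn)
  have top: "T 0 j = 1" "\<And>a. M 0 a = 1" by (simp_all add: M_def T_def)
  interpret column_append "Suc m" k M P "\<lambda>i. T i j" by unfold_locales (rule X)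
  define y where "y = (\<lambda>a. \<Sum>i<Suc m. P a i * w i)"
  have k_le: "k \<le> Suc m" by (rule mp_inverse_on_le[OF X])
  \<comment> \<open>Row 0 of \<open>r = 0\<close> says that the entries of \<open>d\<close> sum to
    1, so they cannot all be nonpositive. In particular an empty basis always leads to an
    append.\<close>
  have ex: "\<exists>a<k. 0 < d a" if "rho = 0"
  proof (rule ccontr)
    assume "\<not> (\<exists>a<k. 0 < d a)"
    then have "(\<Sum>a<k. d a) \<le> 0" by (meson lessThan_iff not_less sum_nonpos)
    moreover have "r 0 = 0" using that by (simp add: rho_zero_iff)
    ultimately show False by (simp add: r_def top)
  qed
  have Ac: "dim_row A = m" "dim_col A = n" using A by auto
  have zm: "dim_vec z = m" using z A by simp
  obtain s' t l k' g tau where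
    e: "exec basis_step s = (s', t)" "t \<le> 9 * (k * Suc m) + 5 * Suc m + 6 * k + 1"
    and cases: "rho \<noteq> 0 \<and> l = k \<and> k' = Suc k \<and> (\<forall>i<Suc m. g i = r i / rho) \<or>
        rho = 0 \<and> l < k \<and> k' = k \<and> 0 < d l \<and> (\<forall>b<k. 0 < d b \<longrightarrow> y l / d l \<le> y b / d b) \<and>
         (\<forall>i<Suc m. g i = P l i / d l)"
    and tau: "tau = (\<Sum>i<Suc m. g i * w i)"
    and out: "nats s' ''k_out'' 0 0 = k'"
      "\<And>a. a < k' \<Longrightarrow> nats s' ''B_out'' a 0 = (if a = l then j else B ! a)"
      "\<And>a i. a < k' \<Longrightarrow> i < Suc m \<Longrightarrow> reals s' ''P_out'' a i = (if a = l then g i else P a i - d a * g i)"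
    and xj: "reals s' ''x_out'' j 0 = tau"
    and xB: "\<And>a. a < k \<Longrightarrow> reals s' ''x_out'' (B ! a) 0 = y a - d a * tau"
    and xz: "\<And>c. c < n \<Longrightarrow> c \<notin> insert j (set B) \<Longrightarrow> reals s' ''x_out'' c 0 = 0"
  proof (rule run_basis_step[of s m n k j B A z P T w d y r rho])
    show "nats s ''m'' 0 0 = m" "nats s ''n'' 0 0 = n" "nats s ''k'' 0 0 = k" "nats s ''j'' 0 0 = j"
      "\<And>a. a < k \<Longrightarrow> nats s ''B'' a 0 = B ! a"
      "\<And>i l. i < m \<Longrightarrow> l < n \<Longrightarrow> reals s ''A'' i l = A $$ (i, l)"
      "\<And>i. i < m \<Longrightarrow> reals s ''z'' i 0 = z $ i"
      "\<And>a i. a < k \<Longrightarrow> i < Suc m \<Longrightarrow> reals s ''P'' a i = P a i"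
      using inp Ac zm Pc
      by (simp_all add: input_state_def holds_nat_def holds_list_def holds_vec_def holds_mat_def k_def P_def)
    show "d = (\<lambda>a. \<Sum>i<Suc m. P a i * T i j)" by (simp add: d_def fun_eq_iff)
    show "r = (\<lambda>i. T i j - (\<Sum>a<k. T i (B ! a) * d a))" by (simp add: r_def M_def fun_eq_iff)
    show "\<And>a. a < k \<Longrightarrow> B ! a < n" by (rule Bn)
    show "\<exists>a<k. 0 < d a" if "rho = 0" using ex[OF that] .
    show "k = length B" "distinct B" "j \<notin> set B" "j < n" by (fact k_def dB j)+
    show "T = (\<lambda>i l. if i = 0 then 1 else A $$ (i - 1, l))" "w = (\<lambda>i. if i = 0 then 1 else z $ (i - 1))"
      "y = (\<lambda>a. \<Sum>i<Suc m. P a i * w i)" "rho = (\<Sum>i<Suc m. r i * r i)"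
      by (fact T_def w_def y_def rho_def)+
  qed (rule that)
  \<comment> \<open>\<open>Bp\<close>, \<open>xp\<close> and \<open>Pp\<close> are what the final
    memory holds; the rest of the proof shows that they have the required properties.\<close>
  define Bp where "Bp = (if l < k then B[l := j] else B @ [j])"
  define xp where "xp = vec n (\<lambda>c. reals s' ''x_out'' c 0)"
  define Pp where "Pp = mat k' (Suc m) (\<lambda>(a, i). reals s' ''P_out'' a i)"
  have k': "length Bp = k'" using cases by (auto simp: Bp_def k_def)
  have l: "l < k'" using cases by auto
  have Bp: "Bp ! a = (if a = l then j else B ! a)" if "a < k'" for a
    using that cases by (auto simp: Bp_def k_def nth_append nth_list_update)
  have sBp: "set Bp \<subseteq> set (B @ [j])" using set_update_subset_insert[of B l j] by (auto simp: Bp_def)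
  have oBp: "ordered_index_set n Bp"
    using sB j dB sBp by (auto simp: ordered_index_set_def Bp_def distinct_list_update)
  then have sBpn: "set Bp \<subseteq> {..<n}" by (simp add: ordered_index_set_def)
  have sumsplit: "(\<Sum>c<n. f c) = (\<Sum>a<k. f (B ! a)) + f j"
    if "\<And>c. c < n \<Longrightarrow> c \<notin> insert j (set B) \<Longrightarrow> f c = 0" for f :: "nat \<Rightarrow> real"
    unfolding k_def by (rule sum_insert_nth[OF dB j(2)]) (use sB j that in auto)
  have xnn: "0 \<le> x $ c" if "c < n" for c using x that by (simp add: simplex_def)
  have "(\<Sum>c<n. \<bar>x $ c\<bar>) = (\<Sum>a<k. \<bar>x $ (B ! a)\<bar>) + \<bar>x $ j\<bar>"
    by (rule sumsplit) (use x0 in auto)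
  then have xsum: "(\<Sum>a<k. x $ (B ! a)) + x $ j = 1"
    using x xnn Bn j by (simp add: simplex_def)
  \<comment> \<open>Row 0 says that the coordinates of \<open>x\<close> sum to 1, the other rows are
    the given representation of \<open>z\<close>.\<close>
  have w_eq: "w i = (\<Sum>a<k. M i a * x $ (B ! a)) + x $ j * T i j" if i: "i < Suc m" for i
  proof (cases "i = 0")
    case True
    then show ?thesis using xsum by (simp add: w_def M_def T_def)
  next
    case False
    then have i1: "i - 1 < m" using i by simp
    have "z $ (i - 1) = (sub_cols A B *\<^sub>v sub_vec x B) $ (i - 1) + x $ j * A $$ (i - 1, j)"
      using i1 j(1) unfolding z by (simp add: Ac del: index_mult_mat_vec)
    also have "(sub_cols A B *\<^sub>v sub_vec x B) $ (i - 1) = (\<Sum>a<k. A $$ (i - 1, B ! a) * x $ (B ! a))"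
      unfolding sub_cols_mult_vec(1)[OF A sB sub_vec_carrier i1] k_def by (simp add: sub_vec_index)
    finally show ?thesis using False by (simp add: w_def M_def T_def)
  qed
  have w_all: "\<forall>i<Suc m. w i = (\<Sum>a<k. M i a * x $ (B ! a)) + x $ j * T i j" using w_eq by blast
  have c_all: "\<forall>a<k. 0 \<le> x $ (B ! a)" using xnn Bn by blast
  \<comment> \<open>The coordinates of \<open>x\<close> at the old basis and at \<open>j\<close>
    serve as the nonnegative solution \<open>c\<close>, \<open>t\<close>.\<close>
  note pt = pivot_point[OF w_all c_all xnn[OF j(1)] fun_cong[OF y_def] tau cases]
  have pinvBp: "pinv (sub_cols (ones_on_top A) Bp) = Pp"
    and mp: "mp_inverse_on (Suc m) k' (\<lambda>i a. sub_cols (ones_on_top A) Bp $$ (i, a)) (\<lambda>a i. Pp $$ (a, i))"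
  proof -
    note S' = sub_cols_ones_on_top[OF A sBpn, unfolded k']
    show mp: "mp_inverse_on (Suc m) k' (\<lambda>i a. sub_cols (ones_on_top A) Bp $$ (i, a)) (\<lambda>a i. Pp $$ (a, i))"
      by (rule mp_inverse_on_cong[OF pt(1)]) (auto simp: S'(2) Pp_def out Bp M_def T_def)
    show "pinv (sub_cols (ones_on_top A) Bp) = Pp"
      by (rule pinv_unique[OF S'(1) _ mp]) (simp add: Pp_def)
  qed
  have aff: "affinely_independent_cols (sub_cols A Bp)"
    unfolding affinely_independent_iff_injective[OF A sBpn] k'
    using mp_inverse_on_injective[OF sub_cols_ones_on_top(1)[OF A sBpn, unfolded k'] _ mp] by (auto simp: Pp_def)
  have xpnn: "0 \<le> xp $ c" if "c < n" for c
  proof (cases "c \<in> insert j (set B)")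
    case True
    then consider "c = j" | a where "a < k" "c = B ! a" by (auto simp: in_set_conv_nth k_def)
    then show ?thesis
    proof cases
      case 1
      then show ?thesis using that xj pt(2) by (simp add: xp_def)
    next
      case (2 a)
      then show ?thesis using that xB[OF 2(1)] pt(3)[OF 2(1)] by (simp add: xp_def)
    qed
  qed (use that xz in \<open>simp add: xp_def\<close>)
  have "(\<Sum>c<n. xp $ c) = (\<Sum>a<k. xp $ (B ! a)) + xp $ j"
    by (rule sumsplit) (use xz in \<open>auto simp: xp_def\<close>)
  \<comment> \<open>As row 0 of the lifted matrix consists of ones, the sum of the new coordinates
    is row 0 of the lifted system, whose right-hand side is \<open>w 0 = 1\<close>.\<close>
  also have "\<dots> = (\<Sum>a<k. M 0 a * (y a - d a * tau)) + tau * T 0 j"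
    using xB xj Bn j by (simp add: xp_def top)
  also have "\<dots> = 1" using pt(5)[of 0] by (simp add: w_def)
  finally have xps: "xp \<in> simplex n" using xpnn by (simp add: simplex_def xp_def)
  have zeq: "z = sub_cols A Bp *\<^sub>v sub_vec xp Bp"
  proof (rule eq_vecI)
    have c: "sub_vec xp Bp \<in> carrier_vec (length Bp)" by (rule sub_vec_carrier)
    note SM = sub_cols_mult_vec[OF A sBpn c]
    show "dim_vec z = dim_vec (sub_cols A Bp *\<^sub>v sub_vec xp Bp)" using carrier_vecD[OF SM(2)] zm by (simp only:)
    fix i assume "i < dim_vec (sub_cols A Bp *\<^sub>v sub_vec xp Bp)"
    then have i: "i < m" using carrier_vecD[OF SM(2)] by (simp only:)
    have "(sub_cols A Bp *\<^sub>v sub_vec xp Bp) $ i = (\<Sum>a<k'. A $$ (i, Bp ! a) * xp $ (Bp ! a))"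
      using sub_vec_index i by (simp add: SM(1) k' del: index_mult_mat_vec)
    also have "\<dots> = A $$ (i, j) * tau + (\<Sum>a\<in>{..<k'} - {l}. A $$ (i, Bp ! a) * xp $ (Bp ! a))"
      using l j xj by (subst sum.remove[of _ l]) (auto simp: Bp xp_def)
    also have "(\<Sum>a\<in>{..<k'} - {l}. A $$ (i, Bp ! a) * xp $ (Bp ! a))
        = (\<Sum>a\<in>{..<k} - {l}. M (Suc i) a * (y a - d a * tau))"
    proof (rule sum.cong)
      show "{..<k'} - {l} = {..<k} - {l}" using cases by auto
      fix a assume "a \<in> {..<k} - {l}"
      then have a: "a < k" "a \<noteq> l" "a < k'" using cases by auto
      have "xp $ (B ! a) = y a - d a * tau" using Bn[OF a(1)] xB[OF a(1)] by (simp add: xp_def)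
      moreover have "A $$ (i, B ! a) = M (Suc i) a" by (simp add: M_def T_def)
      ultimately show "A $$ (i, Bp ! a) * xp $ (Bp ! a) = M (Suc i) a * (y a - d a * tau)"
        using Bp[OF a(3)] a(2) by simp
    qed
    \<comment> \<open>The term at \<open>l\<close> can be restored: in an exchange the leaving
      coordinate is 0, and in an append \<open>l\<close> lies outside the range.\<close>
    also have "\<dots> = (\<Sum>a<k. M (Suc i) a * (y a - d a * tau))"
      using pt(4) by (intro sum.mono_neutral_left) auto
    finally show "z $ i = (sub_cols A Bp *\<^sub>v sub_vec xp Bp) $ i"
      using pt(5)[of "Suc i"] i by (simp add: w_def T_def mult.commute del: index_mult_mat_vec)
  qed
  have outs: "output_state s' xp Bp (pinv (sub_cols (ones_on_top A) Bp))"
    unfolding pinvBp output_state_def holds_nat_def holds_list_def holds_vec_def holds_mat_def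
    by (auto simp: k' out Bp xp_def Pp_def)
  have "t \<le> 84 * m\<^sup>2"
  proof -
    \<comment> \<open>Here 21 is \<open>9 + 5 + 6 + 1\<close>, as each summand is at most a multiple
      of \<open>Y = (2 * m) * (2 * m)\<close>. This uses \<open>k \<le> Suc m\<close> and, for
      \<open>m \<ge> 1\<close>, \<open>Suc m \<le> 2 * m\<close>; four times 21 gives the constant
      84.\<close>
    have add: "t \<le> 21 * Y" if "t \<le> 9 * X + 5 * q + 6 * k + 1" "X \<le> Y" "q \<le> Y" "k \<le> q" "1 \<le> q" for X Y q
      using that by linarith
    have le: "Suc m * Suc m \<le> (2 * m) * (2 * m)" using m by (intro mult_le_mono) auto
    have "t \<le> 21 * ((2 * m) * (2 * m))"
    proof (rule add[OF e(2) _ _ k_le])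
      show "k * Suc m \<le> (2 * m) * (2 * m)" using mult_le_mono1[OF k_le] le by (rule order_trans)
      show "Suc m \<le> (2 * m) * (2 * m)" by (rule order_trans[OF _ le]) simp
    qed simp
    then show ?thesis by (simp add: power2_eq_square)
  qed
  then show ?thesis using e(1) outs xps oBp sBp zeq aff by blast
qed

theorem theorem1:
  shows "\<exists>(p :: prog) (C :: nat).
    \<forall>(m :: nat) (n :: nat) (A :: real mat) (B :: nat list) (j :: nat)
      (x :: real vec) (z :: real vec) (s :: state).
      m \<ge> 1 \<and>
      A \<in> carrier_mat m n \<and>
      ordered_index_set n B \<and>
      affinely_independent_cols (sub_cols A B) \<and>
      j < n \<and> j \<notin> set B \<and>
      x \<in> simplex n \<and> (\<forall>i<n. i \<notin> set (B @ [j]) \<longrightarrow> x $ i = 0) \<and>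
      z = A *\<^sub>v x \<and> z = sub_cols A B *\<^sub>v sub_vec x B + (x $ j) \<cdot>\<^sub>v col A j \<and>
      input_state s A B j z (pinv (sub_cols (ones_on_top A) B))
      \<longrightarrow>
      (\<exists>s' t xp Bp.
        exec p s = (s', t) \<and> t \<le> C * m\<^sup>2 \<and>
        output_state s' xp Bp (pinv (sub_cols (ones_on_top A) Bp)) \<and>
        xp \<in> simplex n \<and>
        ordered_index_set n Bp \<and> set Bp \<subseteq> set (B @ [j]) \<and>
        z = A *\<^sub>v x \<and> z = sub_cols A Bp *\<^sub>v sub_vec xp Bp \<and>
        affinely_independent_cols (sub_cols A Bp))"
proof (rule exI[of _ basis_step], rule exI[of _ 84], intro allI impI, elim conjE)
  fix m n A B j x z s
  assume "m \<ge> 1" "A \<in> carrier_mat m n" "ordered_index_set n B" "affinely_independent_cols (sub_cols A B)"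
    "j < n" "j \<notin> set B" "x \<in> simplex n" "\<forall>i<n. i \<notin> set (B @ [j]) \<longrightarrow> x $ i = 0"
    and zx: "z = A *\<^sub>v x" and "z = sub_cols A B *\<^sub>v sub_vec x B + (x $ j) \<cdot>\<^sub>v col A j"
    "input_state s A B j z (pinv (sub_cols (ones_on_top A) B))"
  then obtain s' t xp Bp where "exec basis_step s = (s', t)" "t \<le> 84 * m\<^sup>2"
    "output_state s' xp Bp (pinv (sub_cols (ones_on_top A) Bp))" "xp \<in> simplex n" "ordered_index_set n Bp"
    "set Bp \<subseteq> set (B @ [j])" "z = sub_cols A Bp *\<^sub>v sub_vec xp Bp" "affinely_independent_cols (sub_cols A Bp)"
    using basis_step_correct[of m A n B j x z s] by metis
  then show "\<exists>s' t xp Bp. exec basis_step s = (s', t) \<and> t \<le> 84 * m\<^sup>2 \<and>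
        output_state s' xp Bp (pinv (sub_cols (ones_on_top A) Bp)) \<and>
        xp \<in> simplex n \<and> ordered_index_set n Bp \<and> set Bp \<subseteq> set (B @ [j]) \<and>
        z = A *\<^sub>v x \<and> z = sub_cols A Bp *\<^sub>v sub_vec xp Bp \<and>
        affinely_independent_cols (sub_cols A Bp)"
    using zx by metis
qed

end
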